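(* Let $R$ be a commutative refinement ring and let $f_1,\dots,f_n\in R$ be nonzero elements generating the unit ideal, i.e. $R=(f_1,\dots,f_n)$. Let $M$ and $N$ be finitely generated projective $R$-modules. Then $M\cong N$ if and only if $M_{(f_i)}\cong N_{(f_i)}$ for each $i=1,\dots,n$.
   Context: A ring $R$ is a refinement ring if the monoid $V(R)$ of isomorphism classes of finitely generated projective $R$-modules (under direct sum) has the refinement property: whenever $x_1+x_2=y_1+y_2$ in $V(R)$, there exist $z_{ij}\in V(R)$ with $x_i=z_{i1}+z_{i2}$ and $y_j=z_{1j}+z_{2j}$. For $0\neq x\in R$, let $S=\{1,x,x^2,\dots\}$, $R_{(x)}=S^{-1}R$ and $M_{(x)}=S^{-1}M$. $(f_1,\dots,f_n)$ denotes the ideal generated by $f_1,\dots,f_n$. *)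

theory Defs
  imports "HOL-Algebra.Algebra"
begin

definition iso_mod :: "('a, 'c) ring_scheme \<Rightarrow> ('a, 'b, 'd) module_scheme \<Rightarrow> ('a, 'e, 'f) module_scheme \<Rightarrow> bool" where
  "iso_mod R M N \<longleftrightarrow> module R M \<and> module R N \<and>
     (\<exists>h. bij_betw h (carrier M) (carrier N) \<and>
        (\<forall>x\<in>carrier M. \<forall>y\<in>carrier M. h (x \<oplus>\<^bsub>M\<^esub> y) = h x \<oplus>\<^bsub>N\<^esub> h y) \<and>
        (\<forall>r\<in>carrier R. \<forall>x\<in>carrier M. h (r \<odot>\<^bsub>M\<^esub> x) = r \<odot>\<^bsub>N\<^esub> h x))"

definition dsum :: "('a, 'b) module \<Rightarrow> ('a, 'c) module \<Rightarrow> ('a, 'b \<times> 'c) module" where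
  "dsum M N = \<lparr> carrier = carrier M \<times> carrier N,
                monoid.mult = undefined, monoid.one = undefined,
                ring.zero = (\<zero>\<^bsub>M\<^esub>, \<zero>\<^bsub>N\<^esub>),
                ring.add = (\<lambda>(x1, y1) (x2, y2). (x1 \<oplus>\<^bsub>M\<^esub> x2, y1 \<oplus>\<^bsub>N\<^esub> y2)),
                module.smult = (\<lambda>r (x, y). (r \<odot>\<^bsub>M\<^esub> x, r \<odot>\<^bsub>N\<^esub> y)) \<rparr>"

definition freemod :: "'a ring \<Rightarrow> nat \<Rightarrow> ('a, nat \<Rightarrow> 'a) module" where
  "freemod R n = \<lparr> carrier = {v. (\<forall>i. v i \<in> carrier R) \<and> (\<forall>i\<ge>n. v i = \<zero>\<^bsub>R\<^esub>)},
                  monoid.mult = undefined, monoid.one = undefined,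
                  ring.zero = (\<lambda>_. \<zero>\<^bsub>R\<^esub>),
                  ring.add = (\<lambda>v w i. v i \<oplus>\<^bsub>R\<^esub> w i),
                  module.smult = (\<lambda>r v i. r \<otimes>\<^bsub>R\<^esub> v i) \<rparr>"

definition fg_projective :: "'a ring \<Rightarrow> ('a, 'b) module \<Rightarrow> bool" where
  "fg_projective R M \<longleftrightarrow> module R M \<and>
     (\<exists>n P Q. submodule P R (freemod R n) \<and> submodule Q R (freemod R n) \<and>
        P \<inter> Q = {\<zero>\<^bsub>freemod R n\<^esub>} \<and>
        (\<forall>v\<in>carrier (freemod R n). \<exists>p\<in>P. \<exists>q\<in>Q. v = p \<oplus>\<^bsub>freemod R n\<^esub> q) \<and>
        iso_mod R M ((freemod R n)\<lparr>carrier := P\<rparr>))"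

text \<open>Elements of V(R) are represented by f.g. projective modules with carrier in the
  fixed type nat => 'a (every f.g. projective module is isomorphic to one of these,
  namely a submodule of some R^n). Addition in V(R) is direct sum, equality is isomorphism.\<close>

definition refinement_ring :: "'a ring \<Rightarrow> bool" where
  "refinement_ring R \<longleftrightarrow>
    (\<forall>X1 :: ('a, nat \<Rightarrow> 'a) module. \<forall>X2 :: ('a, nat \<Rightarrow> 'a) module. \<forall>Y1 :: ('a, nat \<Rightarrow> 'a) module. \<forall>Y2 :: ('a, nat \<Rightarrow> 'a) module.
       fg_projective R X1 \<and> fg_projective R X2 \<and> fg_projective R Y1 \<and> fg_projective R Y2 \<and>
       iso_mod R (dsum X1 X2) (dsum Y1 Y2) \<longrightarrow>
       (\<exists>Z11 :: ('a, nat \<Rightarrow> 'a) module. \<exists>Z12 :: ('a, nat \<Rightarrow> 'a) module. \<exists>Z21 :: ('a, nat \<Rightarrow> 'a) module. \<exists>Z22 :: ('a, nat \<Rightarrow> 'a) module.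
          fg_projective R Z11 \<and> fg_projective R Z12 \<and> fg_projective R Z21 \<and> fg_projective R Z22 \<and>
          iso_mod R X1 (dsum Z11 Z12) \<and> iso_mod R X2 (dsum Z21 Z22) \<and>
          iso_mod R Y1 (dsum Z11 Z21) \<and> iso_mod R Y2 (dsum Z12 Z22)))"

text \<open>Fractions a/x^k are pairs (a,k); (a,k) ~ (b,l) iff x^m (x^l a - x^k b) = 0 for some m.\<close>

definition loc_rel :: "('a, 'c) ring_scheme \<Rightarrow> ('a, 'b, 'd) module_scheme \<Rightarrow> 'a \<Rightarrow> (('b \<times> nat) \<times> ('b \<times> nat)) set" where
  "loc_rel R M x = {((m, k), (n, l)). m \<in> carrier M \<and> n \<in> carrier M \<and>
      (\<exists>j::nat. (x [^]\<^bsub>R\<^esub> j) \<odot>\<^bsub>M\<^esub> (((x [^]\<^bsub>R\<^esub> l) \<odot>\<^bsub>M\<^esub> m) \<ominus>\<^bsub>M\<^esub> ((x [^]\<^bsub>R\<^esub> k) \<odot>\<^bsub>M\<^esub> n)) = \<zero>\<^bsub>M\<^esub>)}"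

definition self_mod :: "'a ring \<Rightarrow> ('a, 'a) module" where
  "self_mod R = \<lparr> carrier = carrier R, monoid.mult = monoid.mult R, monoid.one = monoid.one R, ring.zero = ring.zero R,
                  ring.add = ring.add R, module.smult = monoid.mult R \<rparr>"

definition Rloc :: "'a ring \<Rightarrow> 'a \<Rightarrow> ('a \<times> nat) set ring" where
  "Rloc R x = (let E = loc_rel R (self_mod R) x in
     \<lparr> carrier = (carrier R \<times> UNIV) // E,
       monoid.mult = (\<lambda>C D. \<Union>{E `` {(a \<otimes>\<^bsub>R\<^esub> b, k + l)} | a k b l. (a, k) \<in> C \<and> (b, l) \<in> D}),
       monoid.one = E `` {(\<one>\<^bsub>R\<^esub>, 0)},
       ring.zero = E `` {(\<zero>\<^bsub>R\<^esub>, 0)},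
       ring.add = (\<lambda>C D. \<Union>{E `` {((x [^]\<^bsub>R\<^esub> l) \<otimes>\<^bsub>R\<^esub> a \<oplus>\<^bsub>R\<^esub> (x [^]\<^bsub>R\<^esub> k) \<otimes>\<^bsub>R\<^esub> b, k + l)}
                          | a k b l. (a, k) \<in> C \<and> (b, l) \<in> D}) \<rparr>)"

definition Mloc :: "'a ring \<Rightarrow> ('a, 'b) module \<Rightarrow> 'a \<Rightarrow> (('a \<times> nat) set, ('b \<times> nat) set) module" where
  "Mloc R M x = (let E = loc_rel R M x in
     \<lparr> carrier = (carrier M \<times> UNIV) // E,
       monoid.mult = undefined, monoid.one = undefined,
       ring.zero = E `` {(\<zero>\<^bsub>M\<^esub>, 0)},
       ring.add = (\<lambda>C D. \<Union>{E `` {((x [^]\<^bsub>R\<^esub> l) \<odot>\<^bsub>M\<^esub> m \<oplus>\<^bsub>M\<^esub> (x [^]\<^bsub>R\<^esub> k) \<odot>\<^bsub>M\<^esub> n, k + l)}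
                          | m k n l. (m, k) \<in> C \<and> (n, l) \<in> D}),
       module.smult = (\<lambda>C D. \<Union>{E `` {(a \<odot>\<^bsub>M\<^esub> m, k + l)} | a k m l. (a, k) \<in> C \<and> (m, l) \<in> D}) \<rparr>)"

end

theory Submission
  imports Defs
begin

text \<open>Over a commutative refinement ring, refining \<open>[P] + [Q] = n [R]\<close> shows that every finitely
  generated projective module is a finite direct sum of cyclic projective modules, i.e. of ideals
  \<open>e R\<close> with \<open>e\<close> idempotent. Such a sum is determined up to isomorphism by its ranks at the prime
  ideals \<open>P\<close>, the rank at \<open>P\<close> being the number of summands with \<open>e \<notin> P\<close>: after splitting along the
  Boolean algebra generated by all idempotents involved, each piece is free over a corner ring \<open>g R\<close>,
  and some prime ideal avoids \<open>g\<close> unless \<open>g = 0\<close>. Finally, no prime ideal contains all \<open>f\<^sub>i\<close>, and the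
  rank at \<open>P\<close> can be read off from the localization at any \<open>f\<^sub>i \<notin> P\<close>.\<close>

section \<open>Isomorphisms and direct sums of modules\<close>

text \<open>What makes refinement effective is the rank one case. If \<open>R\<close> is isomorphic
  to \<open>Z \<oplus> W\<close>, the \<open>Z\<close>-component of the image of \<open>1\<close>
  generates \<open>Z\<close>, and its own coordinate is an idempotent \<open>c\<close> with
  \<open>Z\<close> isomorphic to \<open>c R\<close>. Refining against \<open>R^n \<oplus> R\<close>
  therefore splits off one such ideal and leaves a summand of \<open>R^n\<close> for the induction.
  Ranks are compared without residue fields and without localizing at \<open>P\<close>. Linear
  algebra modulo \<open>P\<close> is done with elements of \<open>R\<close>, division being replaced
  by cross-multiplication, which is harmless because a product of elements outside \<open>P\<close>
  stays outside \<open>P\<close>. If one side had the larger rank, the isomorphism over the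
  localization would send some element with a coordinate outside \<open>P\<close> to one with all
  coordinates in \<open>P\<close>. The inverse isomorphism is linear, so it maps the latter back to
  a fraction with numerator coordinates in \<open>P\<close>. Denominators are powers of some
  \<open>f i\<close> outside \<open>P\<close> and do not disturb this contradiction. Each inequality
  of ranks comes from one direction of the isomorphism.\<close>

lemma iso_modI:
  assumes "module R M" "module R N"
    and "\<And>x. x \<in> carrier M \<Longrightarrow> h x \<in> carrier N" "\<And>y. y \<in> carrier N \<Longrightarrow> k y \<in> carrier M"
    and "\<And>x. x \<in> carrier M \<Longrightarrow> k (h x) = x" "\<And>y. y \<in> carrier N \<Longrightarrow> h (k y) = y"
    and "\<And>x y. x \<in> carrier M \<Longrightarrow> y \<in> carrier M \<Longrightarrow> h (x \<oplus>\<^bsub>M\<^esub> y) = h x \<oplus>\<^bsub>N\<^esub> h y"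
    and "\<And>r x. r \<in> carrier R \<Longrightarrow> x \<in> carrier M \<Longrightarrow> h (r \<odot>\<^bsub>M\<^esub> x) = r \<odot>\<^bsub>N\<^esub> h x"
  shows "iso_mod R M N"
  unfolding iso_mod_def
proof (intro conjI exI[of _ h])
  show "bij_betw h (carrier M) (carrier N)"
    by (rule bij_betw_byWitness[where f' = k]) (use assms in auto)
qed (use assms in auto)

text \<open>The inverse is made available together with its linearity, because the comparison of
  ranks has to apply both directions of one isomorphism. Linearity of \<open>k\<close> follows by
  writing its arguments as values of \<open>h\<close>.\<close>

lemma iso_modE:
  assumes "iso_mod R M N"
  obtains h k where "module R M" "module R N"
    and "\<And>x. x \<in> carrier M \<Longrightarrow> h x \<in> carrier N" "\<And>y. y \<in> carrier N \<Longrightarrow> k y \<in> carrier M"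
    and "\<And>x. x \<in> carrier M \<Longrightarrow> k (h x) = x" "\<And>y. y \<in> carrier N \<Longrightarrow> h (k y) = y"
    and "\<And>x y. x \<in> carrier M \<Longrightarrow> y \<in> carrier M \<Longrightarrow> h (x \<oplus>\<^bsub>M\<^esub> y) = h x \<oplus>\<^bsub>N\<^esub> h y"
    and "\<And>r x. r \<in> carrier R \<Longrightarrow> x \<in> carrier M \<Longrightarrow> h (r \<odot>\<^bsub>M\<^esub> x) = r \<odot>\<^bsub>N\<^esub> h x"
    and "\<And>x y. x \<in> carrier N \<Longrightarrow> y \<in> carrier N \<Longrightarrow> k (x \<oplus>\<^bsub>N\<^esub> y) = k x \<oplus>\<^bsub>M\<^esub> k y"
    and "\<And>r x. r \<in> carrier R \<Longrightarrow> x \<in> carrier N \<Longrightarrow> k (r \<odot>\<^bsub>N\<^esub> x) = r \<odot>\<^bsub>M\<^esub> k x"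
proof -
  from assms obtain h where M: "module R M" and N: "module R N"
    and bij: "bij_betw h (carrier M) (carrier N)"
    and add: "\<And>x y. x \<in> carrier M \<Longrightarrow> y \<in> carrier M \<Longrightarrow> h (x \<oplus>\<^bsub>M\<^esub> y) = h x \<oplus>\<^bsub>N\<^esub> h y"
    and smult: "\<And>r x. r \<in> carrier R \<Longrightarrow> x \<in> carrier M \<Longrightarrow> h (r \<odot>\<^bsub>M\<^esub> x) = r \<odot>\<^bsub>N\<^esub> h x"
    unfolding iso_mod_def by blast
  interpret M: module R M by fact
  define k where "k = the_inv_into (carrier M) h"
  have h: "h x \<in> carrier N" if "x \<in> carrier M" for x
    using bij that by (auto simp: bij_betw_def)
  have k: "k y \<in> carrier M" if "y \<in> carrier N" for y
    using bij that unfolding k_def bij_betw_def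
    by (metis order_refl the_inv_into_into)
  have kh: "k (h x) = x" if "x \<in> carrier M" for x
    using bij that unfolding k_def bij_betw_def by (simp add: the_inv_into_f_f)
  have hk: "h (k y) = y" if "y \<in> carrier N" for y
    using bij that unfolding k_def bij_betw_def by (simp add: f_the_inv_into_f)
  show thesis
  proof (rule that[OF M N h k kh hk add smult])
    fix x y assume *: "x \<in> carrier N" "y \<in> carrier N"
    have "k (x \<oplus>\<^bsub>N\<^esub> y) = k (h (k x \<oplus>\<^bsub>M\<^esub> k y))" using * by (simp add: add k hk)
    also have "\<dots> = k x \<oplus>\<^bsub>M\<^esub> k y" using * k by (simp add: kh)
    finally show "k (x \<oplus>\<^bsub>N\<^esub> y) = k x \<oplus>\<^bsub>M\<^esub> k y" .
  next
    fix r x assume *: "r \<in> carrier R" "x \<in> carrier N"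
    have "k (r \<odot>\<^bsub>N\<^esub> x) = k (h (r \<odot>\<^bsub>M\<^esub> k x))" using * by (simp add: smult k hk)
    also have "\<dots> = r \<odot>\<^bsub>M\<^esub> k x" using * k by (simp add: kh)
    finally show "k (r \<odot>\<^bsub>N\<^esub> x) = r \<odot>\<^bsub>M\<^esub> k x" .
  qed
qed

lemma iso_mod_refl: "module R M \<Longrightarrow> iso_mod R M M"
  by (rule iso_modI[where h = id and k = id]) auto

lemma iso_mod_sym: "iso_mod R M N \<Longrightarrow> iso_mod R N M"
  by (erule iso_modE, rule iso_modI) auto

lemma iso_mod_trans [trans]:
  assumes "iso_mod R M N" "iso_mod R N Q"
  shows "iso_mod R M Q"
proof -
  obtain h k where "module R M" "module R N"
    and "\<And>x. x \<in> carrier M \<Longrightarrow> h x \<in> carrier N" "\<And>y. y \<in> carrier N \<Longrightarrow> k y \<in> carrier M"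
    and "\<And>x. x \<in> carrier M \<Longrightarrow> k (h x) = x" "\<And>y. y \<in> carrier N \<Longrightarrow> h (k y) = y"
    and "\<And>x y. x \<in> carrier M \<Longrightarrow> y \<in> carrier M \<Longrightarrow> h (x \<oplus>\<^bsub>M\<^esub> y) = h x \<oplus>\<^bsub>N\<^esub> h y"
    and "\<And>r x. r \<in> carrier R \<Longrightarrow> x \<in> carrier M \<Longrightarrow> h (r \<odot>\<^bsub>M\<^esub> x) = r \<odot>\<^bsub>N\<^esub> h x"
    by (rule iso_modE[OF assms(1)]) (rule that; (assumption | blast))
  moreover obtain h' k' where "module R N" "module R Q"
    and "\<And>x. x \<in> carrier N \<Longrightarrow> h' x \<in> carrier Q" "\<And>y. y \<in> carrier Q \<Longrightarrow> k' y \<in> carrier N"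
    and "\<And>x. x \<in> carrier N \<Longrightarrow> k' (h' x) = x" "\<And>y. y \<in> carrier Q \<Longrightarrow> h' (k' y) = y"
    and "\<And>x y. x \<in> carrier N \<Longrightarrow> y \<in> carrier N \<Longrightarrow> h' (x \<oplus>\<^bsub>N\<^esub> y) = h' x \<oplus>\<^bsub>Q\<^esub> h' y"
    and "\<And>r x. r \<in> carrier R \<Longrightarrow> x \<in> carrier N \<Longrightarrow> h' (r \<odot>\<^bsub>N\<^esub> x) = r \<odot>\<^bsub>Q\<^esub> h' x"
    by (rule iso_modE[OF assms(2)]) (rule that; (assumption | blast))
  ultimately show ?thesis
    by (intro iso_modI[where h = "\<lambda>x. h' (h x)" and k = "\<lambda>y. k (k' y)"]) auto
qed

lemma carrier_dsum [simp]: "carrier (dsum M N) = carrier M \<times> carrier N"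
  and add_dsum [simp]: "(a, b) \<oplus>\<^bsub>dsum M N\<^esub> (c, d) = (a \<oplus>\<^bsub>M\<^esub> c, b \<oplus>\<^bsub>N\<^esub> d)"
  and smult_dsum [simp]: "r \<odot>\<^bsub>dsum M N\<^esub> (a, b) = (r \<odot>\<^bsub>M\<^esub> a, r \<odot>\<^bsub>N\<^esub> b)"
  and zero_dsum [simp]: "\<zero>\<^bsub>dsum M N\<^esub> = (\<zero>\<^bsub>M\<^esub>, \<zero>\<^bsub>N\<^esub>)"
  by (simp_all add: dsum_def)

lemma module_dsum:
  assumes "module R M" "module R N"
  shows "module R (dsum M N)"
proof -
  interpret M: module R M by fact
  interpret N: module R N by fact
  show ?thesis
  proof (rule moduleI)
    show "abelian_group (dsum M N)"
    proof (rule abelian_groupI)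
      fix x assume "x \<in> carrier (dsum M N)"
      then show "\<exists>y \<in> carrier (dsum M N). y \<oplus>\<^bsub>dsum M N\<^esub> x = \<zero>\<^bsub>dsum M N\<^esub>"
        by (intro bexI[of _ "(\<ominus>\<^bsub>M\<^esub> fst x, \<ominus>\<^bsub>N\<^esub> snd x)"]) (auto simp: M.l_neg N.l_neg)
    qed (auto simp: M.a_ac N.a_ac)
  qed (auto simp: M.smult_l_distr N.smult_l_distr M.smult_r_distr N.smult_r_distr
        M.smult_assoc1 N.smult_assoc1 intro: M.is_cring)
qed

lemma iso_mod_dsum_cong:
  assumes "iso_mod R M M'" "iso_mod R N N'"
  shows "iso_mod R (dsum M N) (dsum M' N')"
proof -
  obtain h k where "module R M" "module R M'"
    and "\<And>x. x \<in> carrier M \<Longrightarrow> h x \<in> carrier M'" "\<And>y. y \<in> carrier M' \<Longrightarrow> k y \<in> carrier M"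
    and "\<And>x. x \<in> carrier M \<Longrightarrow> k (h x) = x" "\<And>y. y \<in> carrier M' \<Longrightarrow> h (k y) = y"
    and "\<And>x y. x \<in> carrier M \<Longrightarrow> y \<in> carrier M \<Longrightarrow> h (x \<oplus>\<^bsub>M\<^esub> y) = h x \<oplus>\<^bsub>M'\<^esub> h y"
    and "\<And>r x. r \<in> carrier R \<Longrightarrow> x \<in> carrier M \<Longrightarrow> h (r \<odot>\<^bsub>M\<^esub> x) = r \<odot>\<^bsub>M'\<^esub> h x"
    by (rule iso_modE[OF assms(1)]) (rule that; (assumption | blast))
  moreover obtain h' k' where "module R N" "module R N'"
    and "\<And>x. x \<in> carrier N \<Longrightarrow> h' x \<in> carrier N'" "\<And>y. y \<in> carrier N' \<Longrightarrow> k' y \<in> carrier N"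
    and "\<And>x. x \<in> carrier N \<Longrightarrow> k' (h' x) = x" "\<And>y. y \<in> carrier N' \<Longrightarrow> h' (k' y) = y"
    and "\<And>x y. x \<in> carrier N \<Longrightarrow> y \<in> carrier N \<Longrightarrow> h' (x \<oplus>\<^bsub>N\<^esub> y) = h' x \<oplus>\<^bsub>N'\<^esub> h' y"
    and "\<And>r x. r \<in> carrier R \<Longrightarrow> x \<in> carrier N \<Longrightarrow> h' (r \<odot>\<^bsub>N\<^esub> x) = r \<odot>\<^bsub>N'\<^esub> h' x"
    by (rule iso_modE[OF assms(2)]) (rule that; (assumption | blast))
  ultimately show ?thesis
    by (intro iso_modI[where h = "map_prod h h'" and k = "map_prod k k'"] module_dsum) auto
qed

section \<open>Direct sums of ideals generated by idempotents\<close>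

locale plain_cring = cring R for R :: "'a ring" (structure)

context plain_cring
begin

text \<open>For idempotents \<open>e i\<close>, finitely many of them nonzero, this is the direct
  sum of the ideals \<open>e i R\<close>: a coordinate lies in \<open>e i R\<close> exactly when
  \<open>e i\<close> fixes it. Indexing by all of \<open>nat\<close> keeps these modules in the
  carrier type over which the refinement property quantifies. The \<open>undefined\<close> fields
  agree with those of \<open>freemod\<close>, so a free module is equal, not merely isomorphic, to
  such a module.\<close>

definition idmod :: "(nat \<Rightarrow> 'a) \<Rightarrow> ('a, nat \<Rightarrow> 'a) module" where
  "idmod e = \<lparr> carrier = {v. \<forall>i. v i \<in> carrier R \<and> e i \<otimes> v i = v i},
               monoid.mult = undefined, monoid.one = undefined,
               ring.zero = (\<lambda>_. \<zero>),
               ring.add = (\<lambda>v w i. v i \<oplus> w i),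
               module.smult = (\<lambda>r v i. r \<otimes> v i) \<rparr>"

definition idem :: "'a \<Rightarrow> bool" where
  "idem a \<longleftrightarrow> a \<in> carrier R \<and> a \<otimes> a = a"

lemma idemD: "idem a \<Longrightarrow> a \<in> carrier R" "idem a \<Longrightarrow> a \<otimes> a = a"
  by (auto simp: idem_def)

lemma idem_zero [simp]: "idem \<zero>" and idem_one [simp]: "idem \<one>"
  by (auto simp: idem_def)

lemma idem_absorb: "idem a \<Longrightarrow> x \<in> carrier R \<Longrightarrow> a \<otimes> (a \<otimes> x) = a \<otimes> x"
  by (metis idemD m_assoc)

lemma idem_mult: "idem a \<Longrightarrow> idem b \<Longrightarrow> idem (a \<otimes> b)"
  unfolding idem_def by (metis m_assoc m_closed m_comm)

lemma idem_compl: "idem a \<Longrightarrow> idem (\<one> \<ominus> a)"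
  unfolding idem_def
proof safe
  assume *: "a \<in> carrier R" "a \<otimes> a = a"
  then show "\<one> \<ominus> a \<in> carrier R" by simp
  have "(\<one> \<ominus> a) \<otimes> (\<one> \<ominus> a) = \<one> \<ominus> a \<ominus> a \<oplus> a \<otimes> a" using *(1) by algebra
  also have "\<dots> = \<one> \<ominus> a" unfolding *(2) using *(1) by algebra
  finally show "(\<one> \<ominus> a) \<otimes> (\<one> \<ominus> a) = \<one> \<ominus> a" .
qed

lemma idem_compl_mult: "idem a \<Longrightarrow> (\<one> \<ominus> a) \<otimes> a = \<zero>"
proof -
  assume *: "idem a"
  have "(\<one> \<ominus> a) \<otimes> a = a \<ominus> a \<otimes> a" using idemD(1)[OF *] by algebra
  also have "\<dots> = \<zero>" using idemD[OF *] by (simp add: minus_eq r_neg)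
  finally show ?thesis .
qed

lemma carrier_idmod: "v \<in> carrier (idmod e) \<longleftrightarrow> (\<forall>i. v i \<in> carrier R \<and> e i \<otimes> v i = v i)"
  and add_idmod [simp]: "v \<oplus>\<^bsub>idmod e\<^esub> w = (\<lambda>i. v i \<oplus> w i)"
  and smult_idmod [simp]: "r \<odot>\<^bsub>idmod e\<^esub> v = (\<lambda>i. r \<otimes> v i)"
  and zero_idmod [simp]: "\<zero>\<^bsub>idmod e\<^esub> = (\<lambda>_. \<zero>)"
  by (simp_all add: idmod_def)

lemma idmod_memD: "v \<in> carrier (idmod e) \<Longrightarrow> v i \<in> carrier R"
  "v \<in> carrier (idmod e) \<Longrightarrow> e i \<otimes> v i = v i"
  by (simp_all add: carrier_idmod)

lemma module_idmod:
  assumes "\<And>i. e i \<in> carrier R"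
  shows "module R (idmod e)"
proof (rule moduleI)
  show "abelian_group (idmod e)"
  proof (rule abelian_groupI)
    fix x assume "x \<in> carrier (idmod e)"
    then show "\<exists>y\<in>carrier (idmod e). y \<oplus>\<^bsub>idmod e\<^esub> x = \<zero>\<^bsub>idmod e\<^esub>"
      using assms
      by (intro bexI[of _ "\<lambda>i. \<ominus> x i"]) (auto simp: carrier_idmod l_neg r_minus)
  qed (use assms in \<open>auto simp: carrier_idmod a_ac r_distr\<close>)
qed (use assms in \<open>auto simp: carrier_idmod r_distr l_distr m_assoc m_lcomm is_cring\<close>)

lemma freemod_eq_idmod: "freemod R n = idmod (\<lambda>i. if i < n then \<one> else \<zero>)"
proof -
  have "(\<forall>i. v i \<in> carrier R) \<and> (\<forall>i\<ge>n. v i = \<zero>) \<longleftrightarrow>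
      (\<forall>i. v i \<in> carrier R \<and> (if i < n then \<one> else \<zero>) \<otimes> v i = v i)" for v :: "nat \<Rightarrow> 'a"
    by (intro iffI conjI allI) (auto simp: not_less, metis l_null not_less)
  then show ?thesis unfolding freemod_def idmod_def by simp
qed

lemma module_freemod: "module R (freemod R n)"
  unfolding freemod_eq_idmod by (rule module_idmod) auto

text \<open>A single ideal \<open>c R\<close> is coded as the family supported at index 0. Since
  \<open>e m = \<zero>\<close>, slot \<open>m\<close> is empty, and the new summand is moved there
  from slot 0.\<close>

lemma idmod_add_one:
  assumes "\<And>i. e i \<in> carrier R" "c \<in> carrier R" "e m = \<zero>"
  shows "iso_mod R (dsum (idmod e) (idmod ((\<lambda>_. \<zero>)(0 := c)))) (idmod (e(m := c)))"
proof (rule iso_modI[where h = "\<lambda>(v, z). v(m := z 0)"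
      and k = "\<lambda>v. (v(m := \<zero>), (\<lambda>_. \<zero>)(0 := v m))"])
  have zero: "v m = \<zero>" if "v \<in> carrier (idmod e)" for v
    using idmod_memD[OF that, of m] assms(3) by simp
  have zero': "z i = \<zero>" if "z \<in> carrier (idmod ((\<lambda>_. \<zero>)(0 := c)))" "i \<noteq> 0" for z i
    using idmod_memD[OF that(1), of i] that(2) by simp
  fix x assume "x \<in> carrier (dsum (idmod e) (idmod ((\<lambda>_. \<zero>)(0 := c))))"
  then obtain v z where x: "x = (v, z)" "v \<in> carrier (idmod e)"
    "z \<in> carrier (idmod ((\<lambda>_. \<zero>)(0 := c)))"
    by auto
  have "v(m := \<zero>) = v" using zero[OF x(2)] by auto
  moreover have "(\<lambda>_. \<zero>)(0 := z 0) = z" using zero'[OF x(3)] by auto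
  ultimately show "(\<lambda>v. (v(m := \<zero>), (\<lambda>_. \<zero>)(0 := v m))) ((\<lambda>(v, z). v(m := z 0)) x) = x"
    using x(1) by simp
  from x assms(2) show "(\<lambda>(v, z). v(m := z 0)) x \<in> carrier (idmod (e(m := c)))"
    using idmod_memD[OF x(2)] idmod_memD[OF x(3), of 0] by (simp add: carrier_idmod)
next
  fix y assume y: "y \<in> carrier (idmod (e(m := c)))"
  have "e i \<otimes> y i = y i" if "i \<noteq> m" for i
    using idmod_memD[OF y, of i] that by simp
  moreover have "c \<otimes> y m = y m"
    using idmod_memD[OF y, of m] by simp
  ultimately show "(y(m := \<zero>), (\<lambda>_. \<zero>)(0 := y m))
      \<in> carrier (dsum (idmod e) (idmod ((\<lambda>_. \<zero>)(0 := c))))"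
    using assms idmod_memD(1)[OF y] by (simp add: carrier_idmod)
qed (use assms in \<open>auto intro!: module_dsum module_idmod\<close>)

text \<open>Multiplication by \<open>h\<close> and by \<open>\<one> \<ominus> h\<close> are
  complementary projections (the Peirce decomposition), applied coordinatewise; adding the two
  components inverts them.\<close>

lemma idmod_split:
  assumes "\<And>i. e i \<in> carrier R" "idem h"
  shows "iso_mod R (idmod e) (dsum (idmod (\<lambda>i. h \<otimes> e i)) (idmod (\<lambda>i. (\<one> \<ominus> h) \<otimes> e i)))"
proof -
  note hc = idemD(1)[OF assms(2)]
  \<comment> \<open>Multiplying \<open>h \<otimes> a \<otimes> x = x\<close> by the idempotent
    \<open>h\<close> gives \<open>h \<otimes> x = x\<close>; the other two equations follow from
    this one.\<close>
  have fix_h: "h \<otimes> x = x" "(\<one> \<ominus> h) \<otimes> x = \<zero>" "a \<otimes> x = x"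
    if "h \<otimes> a \<otimes> x = x" "x \<in> carrier R" "a \<in> carrier R" for a x
  proof -
    show *: "h \<otimes> x = x"
      using that assms(2) hc by (metis idem_absorb m_assoc m_closed)
    have "(\<one> \<ominus> h) \<otimes> x = x \<ominus> h \<otimes> x" using that hc by algebra
    then show "(\<one> \<ominus> h) \<otimes> x = \<zero>" using * that by (simp add: minus_eq r_neg)
    show "a \<otimes> x = x" using that * hc by (metis m_assoc m_comm)
  qed
  have fix_h': "(\<one> \<ominus> h) \<otimes> x = x" "h \<otimes> x = \<zero>" "a \<otimes> x = x"
    if "(\<one> \<ominus> h) \<otimes> a \<otimes> x = x" "x \<in> carrier R" "a \<in> carrier R" for a x
  proof -
    show *: "(\<one> \<ominus> h) \<otimes> x = x"
      using that assms(2) hc by (metis idem_absorb idem_compl m_assoc m_closed minus_closed one_closed)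
    have "h \<otimes> x = x \<ominus> (\<one> \<ominus> h) \<otimes> x" using that hc by algebra
    then show "h \<otimes> x = \<zero>" using * that by (simp add: minus_eq r_neg)
    show "a \<otimes> x = x" using that * hc by (metis m_assoc m_comm minus_closed one_closed)
  qed
  have sum: "h \<otimes> x \<oplus> (\<one> \<ominus> h) \<otimes> x = x" if "x \<in> carrier R" for x
    using that hc by algebra
  have mem: "h \<otimes> a \<otimes> (h \<otimes> x) = h \<otimes> x"
    if "idem h" "a \<otimes> x = x" "x \<in> carrier R" "a \<in> carrier R" for h a x
  proof -
    have "h \<otimes> a \<otimes> (h \<otimes> x) = (h \<otimes> h) \<otimes> (a \<otimes> x)"
      using that(3,4) idemD(1)[OF that(1)] by algebra
    then show ?thesis using that(2) idemD(2)[OF that(1)] by simp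
  qed
  show ?thesis
  proof (rule iso_modI[where h = "\<lambda>v. (\<lambda>i. h \<otimes> v i, \<lambda>i. (\<one> \<ominus> h) \<otimes> v i)"
        and k = "\<lambda>(v, w). \<lambda>i. v i \<oplus> w i"])
    fix x assume "x \<in> carrier (idmod e)"
    then show "(\<lambda>i. h \<otimes> x i, \<lambda>i. (\<one> \<ominus> h) \<otimes> x i)
        \<in> carrier (dsum (idmod (\<lambda>i. h \<otimes> e i)) (idmod (\<lambda>i. (\<one> \<ominus> h) \<otimes> e i)))"
      using mem[OF assms(2)] mem[OF idem_compl[OF assms(2)]] assms(1) hc
      by (simp add: carrier_idmod)
  next
    fix y assume "y \<in> carrier (dsum (idmod (\<lambda>i. h \<otimes> e i)) (idmod (\<lambda>i. (\<one> \<ominus> h) \<otimes> e i)))"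
    then obtain v w where y: "y = (v, w)" "v \<in> carrier (idmod (\<lambda>i. h \<otimes> e i))"
      "w \<in> carrier (idmod (\<lambda>i. (\<one> \<ominus> h) \<otimes> e i))"
      by auto
    have v: "h \<otimes> v i = v i" "(\<one> \<ominus> h) \<otimes> v i = \<zero>" "e i \<otimes> v i = v i" "v i \<in> carrier R" for i
      using idmod_memD[OF y(2), of i] fix_h[of "e i" "v i"] assms(1) by auto
    have w: "(\<one> \<ominus> h) \<otimes> w i = w i" "h \<otimes> w i = \<zero>" "e i \<otimes> w i = w i" "w i \<in> carrier R" for i
      using idmod_memD[OF y(3), of i] fix_h'[of "e i" "w i"] assms(1) by auto
    show "(case y of (v, w) \<Rightarrow> \<lambda>i. v i \<oplus> w i) \<in> carrier (idmod e)"
      using y(1) v w assms(1) by (simp add: carrier_idmod r_distr)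
    show "(\<lambda>v. (\<lambda>i. h \<otimes> v i, \<lambda>i. (\<one> \<ominus> h) \<otimes> v i)) (case y of (v, w) \<Rightarrow> \<lambda>i. v i \<oplus> w i) = y"
      using v w hc by (simp add: y(1) r_distr)
  next
    fix x assume "x \<in> carrier (idmod e)"
    then show "(case (\<lambda>i. h \<otimes> x i, \<lambda>i. (\<one> \<ominus> h) \<otimes> x i) of (v, w) \<Rightarrow> \<lambda>i. v i \<oplus> w i) = x"
      using sum idmod_memD(1) by simp
  next
    fix x y assume "x \<in> carrier (idmod e)" "y \<in> carrier (idmod e)"
    then show "(\<lambda>i. h \<otimes> (x \<oplus>\<^bsub>idmod e\<^esub> y) i, \<lambda>i. (\<one> \<ominus> h) \<otimes> (x \<oplus>\<^bsub>idmod e\<^esub> y) i) =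
      (\<lambda>i. h \<otimes> x i, \<lambda>i. (\<one> \<ominus> h) \<otimes> x i) \<oplus>\<^bsub>dsum (idmod (\<lambda>i. h \<otimes> e i)) (idmod (\<lambda>i. (\<one> \<ominus> h) \<otimes> e i))\<^esub>
      (\<lambda>i. h \<otimes> y i, \<lambda>i. (\<one> \<ominus> h) \<otimes> y i)"
      using hc idmod_memD(1) by (simp add: r_distr)
  next
    fix r x assume "r \<in> carrier R" "x \<in> carrier (idmod e)"
    then show "(\<lambda>i. h \<otimes> (r \<odot>\<^bsub>idmod e\<^esub> x) i, \<lambda>i. (\<one> \<ominus> h) \<otimes> (r \<odot>\<^bsub>idmod e\<^esub> x) i) =
      r \<odot>\<^bsub>dsum (idmod (\<lambda>i. h \<otimes> e i)) (idmod (\<lambda>i. (\<one> \<ominus> h) \<otimes> e i))\<^esub> (\<lambda>i. h \<otimes> x i, \<lambda>i. (\<one> \<ominus> h) \<otimes> x i)"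
      using hc idmod_memD(1) by (simp add: m_lcomm)
  qed (use assms(1) hc in \<open>auto intro!: module_idmod module_dsum\<close>)
qed

text \<open>Vectors are pulled back along the bijection \<open>s\<close> of the supports and
  extended by zero. Thus only the number of copies of \<open>g R\<close> matters, not the slots in
  which they stand.\<close>

lemma idmod_reindex:
  assumes "bij_betw s J I" "g \<in> carrier R"
  shows "iso_mod R (idmod (\<lambda>i. if i \<in> I then g else \<zero>)) (idmod (\<lambda>j. if j \<in> J then g else \<zero>))"
proof -
  let ?t = "the_inv_into J s"
  have st: "s j \<in> I" "?t (s j) = j" if "j \<in> J" for j
    using assms(1) that by (auto simp: bij_betw_def the_inv_into_f_f)
  have ts: "?t i \<in> J" "s (?t i) = i" if "i \<in> I" for i
    using assms(1) that by (auto simp: bij_betw_def f_the_inv_into_f the_inv_into_into)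
  have zero: "v i = \<zero>" if "v \<in> carrier (idmod (\<lambda>i. if i \<in> I then g else \<zero>))" "i \<notin> I" for v i I
    using idmod_memD[OF that(1), of i] that(2) by simp
  have mem_fix: "g \<otimes> v i = v i" if "v \<in> carrier (idmod (\<lambda>i. if i \<in> I then g else \<zero>))" "i \<in> I" for v i I
    using idmod_memD(2)[OF that(1), of i] that(2) by simp
  show ?thesis
  proof (rule iso_modI[where h = "\<lambda>v j. if j \<in> J then v (s j) else \<zero>"
          and k = "\<lambda>v i. if i \<in> I then v (?t i) else \<zero>"])
    fix x assume "x \<in> carrier (idmod (\<lambda>i. if i \<in> I then g else \<zero>))"
    from zero[OF this] show "(\<lambda>i. if i \<in> I then (\<lambda>j. if j \<in> J then x (s j) else \<zero>) (?t i) else \<zero>) = x"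
      using ts by (intro ext) simp
  next
    fix y assume "y \<in> carrier (idmod (\<lambda>j. if j \<in> J then g else \<zero>))"
    from zero[OF this] show "(\<lambda>j. if j \<in> J then (\<lambda>i. if i \<in> I then y (?t i) else \<zero>) (s j) else \<zero>) = y"
      using st by (intro ext) simp
  next
    fix x assume x: "x \<in> carrier (idmod (\<lambda>i. if i \<in> I then g else \<zero>))"
    show "(\<lambda>j. if j \<in> J then x (s j) else \<zero>) \<in> carrier (idmod (\<lambda>j. if j \<in> J then g else \<zero>))"
      using idmod_memD(1)[OF x] mem_fix[OF x] st(1) by (simp add: carrier_idmod)
  next
    fix y assume y: "y \<in> carrier (idmod (\<lambda>j. if j \<in> J then g else \<zero>))"
    show "(\<lambda>i. if i \<in> I then y (?t i) else \<zero>) \<in> carrier (idmod (\<lambda>i. if i \<in> I then g else \<zero>))"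
      using idmod_memD(1)[OF y] mem_fix[OF y] ts(1) by (simp add: carrier_idmod)
  qed (use assms(2) in \<open>auto intro!: module_idmod\<close>)
qed

end

section \<open>Finitely generated projective modules over a refinement ring\<close>

context plain_cring
begin

lemma freemod_Suc: "iso_mod R (freemod R (Suc n)) (dsum (freemod R n) (freemod R 1))"
proof -
  have "(\<lambda>i. if i < Suc n then \<one> else \<zero>) = (\<lambda>i. if i < n then \<one> else \<zero>)(n := \<one>)"
    by (auto simp: fun_eq_iff)
  moreover have "(\<lambda>i::nat. if i < 1 then \<one> else \<zero>) = (\<lambda>_. \<zero>)(0 := \<one>)"
    by (auto simp: fun_eq_iff)
  ultimately show ?thesis
    using idmod_add_one[of "\<lambda>i. if i < n then \<one> else \<zero>" \<one> n]
    unfolding freemod_eq_idmod by (simp add: iso_mod_sym)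
qed

lemma fg_projective_module: "fg_projective R M \<Longrightarrow> module R M"
  by (simp add: fg_projective_def)

lemma summand_fg_projective:
  assumes "submodule P R (freemod R n)" "submodule Q R (freemod R n)"
    and "P \<inter> Q = {\<zero>\<^bsub>freemod R n\<^esub>}"
    and "\<forall>v\<in>carrier (freemod R n). \<exists>p\<in>P. \<exists>q\<in>Q. v = p \<oplus>\<^bsub>freemod R n\<^esub> q"
  shows "fg_projective R ((freemod R n)\<lparr>carrier := P\<rparr>)"
  unfolding fg_projective_def
  using assms submodule.submodule_is_module[OF assms(1) module_freemod]
  by (blast intro: iso_mod_refl)

lemma fg_projective_freemod: "fg_projective R (freemod R n)"
proof -
  interpret F: module R "freemod R n" by (rule module_freemod)
  have "fg_projective R ((freemod R n)\<lparr>carrier := carrier (freemod R n)\<rparr>)"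
  proof (rule summand_fg_projective)
    show "submodule (carrier (freemod R n)) R (freemod R n)"
      by (rule F.carrier_is_submodule)
    show "submodule {\<zero>\<^bsub>freemod R n\<^esub>} R (freemod R n)"
      by (rule F.submoduleI) auto
    show "\<forall>v\<in>carrier (freemod R n). \<exists>p\<in>carrier (freemod R n).
        \<exists>q\<in>{\<zero>\<^bsub>freemod R n\<^esub>}. v = p \<oplus>\<^bsub>freemod R n\<^esub> q"
      using F.r_zero by (metis singletonI)
  qed auto
  then show ?thesis by simp
qed

text \<open>Addition is the isomorphism. It is injective because two decompositions of one element
  give \<open>p - p' = q' - q\<close>, an element of \<open>P \<inter> Q\<close>, hence
  zero.\<close>

lemma internal_direct_sum:
  assumes "module R F" "submodule P R F" "submodule Q R F" "P \<inter> Q = {\<zero>\<^bsub>F\<^esub>}"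
    and "\<forall>v\<in>carrier F. \<exists>p\<in>P. \<exists>q\<in>Q. v = p \<oplus>\<^bsub>F\<^esub> q"
  shows "iso_mod R (dsum (F\<lparr>carrier := P\<rparr>) (F\<lparr>carrier := Q\<rparr>)) F"
proof -
  interpret F: module R F by fact
  note P = F.submoduleE[OF assms(2)] and Q = F.submoduleE[OF assms(3)]
  let ?h = "\<lambda>(p, q). p \<oplus>\<^bsub>F\<^esub> q"
  have inj: "p = p' \<and> q = q'"
    if pq: "p \<in> P" "q \<in> Q" "p' \<in> P" "q' \<in> Q" and eq: "p \<oplus>\<^bsub>F\<^esub> q = p' \<oplus>\<^bsub>F\<^esub> q'" for p q p' q'
  proof -
    have c: "p \<in> carrier F" "q \<in> carrier F" "p' \<in> carrier F" "q' \<in> carrier F"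
      using pq P(1) Q(1) by auto
    have "p \<oplus>\<^bsub>F\<^esub> \<ominus>\<^bsub>F\<^esub> p' = (p \<oplus>\<^bsub>F\<^esub> q) \<oplus>\<^bsub>F\<^esub> (\<ominus>\<^bsub>F\<^esub> q \<oplus>\<^bsub>F\<^esub> \<ominus>\<^bsub>F\<^esub> p')"
      using c by (simp add: F.M.a_assoc F.M.r_neg1 F.M.r_neg2)
    also have "\<dots> = (q' \<oplus>\<^bsub>F\<^esub> \<ominus>\<^bsub>F\<^esub> q) \<oplus>\<^bsub>F\<^esub> (p' \<oplus>\<^bsub>F\<^esub> \<ominus>\<^bsub>F\<^esub> p')"
      unfolding eq using c by (simp add: F.M.a_ac)
    also have "\<dots> = q' \<oplus>\<^bsub>F\<^esub> \<ominus>\<^bsub>F\<^esub> q"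
      using c by (simp add: F.M.r_neg)
    finally have eq': "p \<oplus>\<^bsub>F\<^esub> \<ominus>\<^bsub>F\<^esub> p' = q' \<oplus>\<^bsub>F\<^esub> \<ominus>\<^bsub>F\<^esub> q" .
    moreover have "p \<oplus>\<^bsub>F\<^esub> \<ominus>\<^bsub>F\<^esub> p' \<in> P" "q' \<oplus>\<^bsub>F\<^esub> \<ominus>\<^bsub>F\<^esub> q \<in> Q"
      using pq P(3,5) Q(3,5) by auto
    ultimately have "p \<oplus>\<^bsub>F\<^esub> \<ominus>\<^bsub>F\<^esub> p' = \<zero>\<^bsub>F\<^esub>" "q' \<oplus>\<^bsub>F\<^esub> \<ominus>\<^bsub>F\<^esub> q = \<zero>\<^bsub>F\<^esub>"
      using assms(4) by auto
    then show ?thesis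
      using c F.M.minus_equality[of p "\<ominus>\<^bsub>F\<^esub> p'"] F.M.minus_equality[of q' "\<ominus>\<^bsub>F\<^esub> q"] by simp
  qed
  show ?thesis
    unfolding iso_mod_def
  proof (intro conjI exI[of _ ?h])
    show "bij_betw ?h (carrier (dsum (F\<lparr>carrier := P\<rparr>) (F\<lparr>carrier := Q\<rparr>))) (carrier F)"
      unfolding bij_betw_def
    proof
      show "inj_on ?h (carrier (dsum (F\<lparr>carrier := P\<rparr>) (F\<lparr>carrier := Q\<rparr>)))"
        using inj by (auto simp: inj_on_def)
      show "?h ` carrier (dsum (F\<lparr>carrier := P\<rparr>) (F\<lparr>carrier := Q\<rparr>)) = carrier F"
        using assms(5) P(1) Q(1) by (force simp: image_iff)
    qed
  next
    show "\<forall>x\<in>carrier (dsum (F\<lparr>carrier := P\<rparr>) (F\<lparr>carrier := Q\<rparr>)).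
        \<forall>y\<in>carrier (dsum (F\<lparr>carrier := P\<rparr>) (F\<lparr>carrier := Q\<rparr>)).
        ?h (x \<oplus>\<^bsub>dsum (F\<lparr>carrier := P\<rparr>) (F\<lparr>carrier := Q\<rparr>)\<^esub> y) = ?h x \<oplus>\<^bsub>F\<^esub> ?h y"
      using P(1) Q(1) by (auto simp: subset_iff F.M.a_ac)
  next
    show "\<forall>r\<in>carrier R. \<forall>x\<in>carrier (dsum (F\<lparr>carrier := P\<rparr>) (F\<lparr>carrier := Q\<rparr>)).
        ?h (r \<odot>\<^bsub>dsum (F\<lparr>carrier := P\<rparr>) (F\<lparr>carrier := Q\<rparr>)\<^esub> x) = r \<odot>\<^bsub>F\<^esub> ?h x"
      using P(1) Q(1) by (auto simp: subset_iff F.smult_r_distr)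
  qed (use assms(1) in \<open>auto intro!: module_dsum submodule.submodule_is_module assms\<close>)
qed

text \<open>Let \<open>z\<close> be the \<open>Z\<close>-component of the image of the basis vector.
  It generates \<open>Z\<close>, and reading off coordinates in \<open>R\<close> gives a linear map
  \<open>\<kappa>\<close> with \<open>x = \<kappa> x z\<close>. Applying \<open>\<kappa>\<close>
  once more shows that \<open>c = \<kappa> z\<close> fixes every value of \<open>\<kappa>\<close>,
  in particular itself; so \<open>c\<close> is idempotent and \<open>\<kappa>\<close> identifies
  \<open>Z\<close> with \<open>c R\<close>.\<close>

lemma rank_one_summand:
  assumes "iso_mod R (freemod R 1) (dsum Z W)" "module R Z" "module R W"
  obtains c where "idem c" "iso_mod R Z (idmod ((\<lambda>_. \<zero>)(0 := c)))"
proof -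
  interpret Z: module R Z by fact
  interpret W: module R W by fact
  interpret F: module R "freemod R 1" by (rule module_freemod)
  interpret D: module R "dsum Z W" by (rule module_dsum) fact+
  obtain h k
    where h: "\<And>x. x \<in> carrier (freemod R 1) \<Longrightarrow> h x \<in> carrier (dsum Z W)"
      and k: "\<And>y. y \<in> carrier (dsum Z W) \<Longrightarrow> k y \<in> carrier (freemod R 1)"
      and kh: "\<And>x. x \<in> carrier (freemod R 1) \<Longrightarrow> k (h x) = x"
      and hk: "\<And>y. y \<in> carrier (dsum Z W) \<Longrightarrow> h (k y) = y"
      and hs: "\<And>r x. r \<in> carrier R \<Longrightarrow> x \<in> carrier (freemod R 1) \<Longrightarrow>
        h (r \<odot>\<^bsub>freemod R 1\<^esub> x) = r \<odot>\<^bsub>dsum Z W\<^esub> h x"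
      and ka: "\<And>x y. x \<in> carrier (dsum Z W) \<Longrightarrow> y \<in> carrier (dsum Z W) \<Longrightarrow>
        k (x \<oplus>\<^bsub>dsum Z W\<^esub> y) = k x \<oplus>\<^bsub>freemod R 1\<^esub> k y"
      and ks: "\<And>r x. r \<in> carrier R \<Longrightarrow> x \<in> carrier (dsum Z W) \<Longrightarrow>
        k (r \<odot>\<^bsub>dsum Z W\<^esub> x) = r \<odot>\<^bsub>freemod R 1\<^esub> k x"
    by (rule iso_modE[OF assms(1)]) (rule that; (assumption | blast))
  define u :: "nat \<Rightarrow> 'a" where "u = (\<lambda>_. \<zero>)(0 := \<one>)"
  have u: "u \<in> carrier (freemod R 1)"
    by (auto simp: u_def freemod_eq_idmod carrier_idmod)
  have u_gen: "v = v 0 \<odot>\<^bsub>freemod R 1\<^esub> u" "v 0 \<in> carrier R" if "v \<in> carrier (freemod R 1)" for v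
    using that by (auto simp: freemod_def u_def fun_eq_iff)
  obtain z w where zw: "h u = (z, w)" "z \<in> carrier Z" "w \<in> carrier W"
    using h[OF u] by auto
  \<comment> \<open>The pair \<open>(x, 0)\<close> embeds \<open>Z\<close> into the direct sum;
    \<open>k\<close> takes it to \<open>R^1\<close>, whose only coordinate has index 0.\<close>
  define \<kappa> where "\<kappa> x = k (x, \<zero>\<^bsub>W\<^esub>) 0" for x
  define c where "c = \<kappa> z"
  have \<kappa>: "\<kappa> x \<in> carrier R" if "x \<in> carrier Z" for x
    unfolding \<kappa>_def using that by (intro u_gen(2) k) simp
  have \<kappa>_gen: "x = \<kappa> x \<odot>\<^bsub>Z\<^esub> z" if "x \<in> carrier Z" for x
  proof -
    have x: "(x, \<zero>\<^bsub>W\<^esub>) \<in> carrier (dsum Z W)" using that by simp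
    have "(x, \<zero>\<^bsub>W\<^esub>) = h (\<kappa> x \<odot>\<^bsub>freemod R 1\<^esub> u)"
      unfolding \<kappa>_def using u_gen(1)[OF k[OF x]] hk[OF x] by metis
    also have "\<dots> = \<kappa> x \<odot>\<^bsub>dsum Z W\<^esub> h u" by (rule hs[OF \<kappa>[OF that] u])
    finally show ?thesis by (simp add: zw)
  qed
  have \<kappa>_smult: "\<kappa> (r \<odot>\<^bsub>Z\<^esub> x) = r \<otimes> \<kappa> x" if "r \<in> carrier R" "x \<in> carrier Z" for r x
    using ks[of r "(x, \<zero>\<^bsub>W\<^esub>)"] that by (simp add: \<kappa>_def freemod_eq_idmod)
  have \<kappa>_add: "\<kappa> (x \<oplus>\<^bsub>Z\<^esub> y) = \<kappa> x \<oplus> \<kappa> y" if "x \<in> carrier Z" "y \<in> carrier Z" for x y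
    using ka[of "(x, \<zero>\<^bsub>W\<^esub>)" "(y, \<zero>\<^bsub>W\<^esub>)"] that by (simp add: \<kappa>_def freemod_eq_idmod)
  \<comment> \<open>This is \<open>\<kappa>\<close> applied to \<open>x = \<kappa> x z\<close>. At
    \<open>x = z\<close> it reads \<open>c = c \<otimes> c\<close>.\<close>
  have \<kappa>_c: "\<kappa> x = c \<otimes> \<kappa> x" if "x \<in> carrier Z" for x
    using \<kappa>_smult[OF \<kappa>[OF that] zw(2)] \<kappa>_gen[OF that] \<kappa>[OF that] \<kappa>[OF zw(2)]
    by (simp add: c_def m_comm)
  show thesis
  proof (rule that)
    show c: "idem c" unfolding idem_def
      using \<kappa>_c[OF zw(2)] \<kappa>[OF zw(2)] by (simp add: c_def)
    show "iso_mod R Z (idmod ((\<lambda>_. \<zero>)(0 := c)))"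
    proof (rule iso_modI[where h = "\<lambda>x. (\<lambda>_. \<zero>)(0 := \<kappa> x)" and k = "\<lambda>v. v 0 \<odot>\<^bsub>Z\<^esub> z"])
      fix v assume v: "v \<in> carrier (idmod ((\<lambda>_. \<zero>)(0 := c)))"
      have v': "v i = \<zero>" if "i \<noteq> 0" for i
        using idmod_memD[OF v, of i] that by simp
      have v0: "v 0 \<in> carrier R" "c \<otimes> v 0 = v 0" using idmod_memD[OF v, of 0] by auto
      then show "v 0 \<odot>\<^bsub>Z\<^esub> z \<in> carrier Z" using zw by simp
      have "\<kappa> (v 0 \<odot>\<^bsub>Z\<^esub> z) = v 0"
        using v0 \<kappa>_smult zw(2) idemD(1)[OF c] by (simp add: c_def m_comm)
      then show "(\<lambda>_. \<zero>)(0 := \<kappa> (v 0 \<odot>\<^bsub>Z\<^esub> z)) = v"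
        using v' by (auto simp: fun_eq_iff)
    next
      fix x assume x: "x \<in> carrier Z"
      show "(\<lambda>_. \<zero>)(0 := \<kappa> x) \<in> carrier (idmod ((\<lambda>_. \<zero>)(0 := c)))"
        using \<kappa>[OF x] \<kappa>_c[OF x] by (simp add: carrier_idmod)
      show "((\<lambda>_. \<zero>)(0 := \<kappa> x)) 0 \<odot>\<^bsub>Z\<^esub> z = x"
        using \<kappa>_gen[OF x] by simp
    qed (use idemD(1)[OF c] assms in \<open>auto intro!: module_idmod simp: fun_eq_iff \<kappa>_smult \<kappa>_add\<close>)
  qed
qed

text \<open>The bound \<open>n\<close> makes the sum finite, as needed for counting summands and for
  induction over coordinates. It also guarantees that slot \<open>n\<close> is free for the next
  summand.\<close>

definition idfam :: "(nat \<Rightarrow> 'a) \<Rightarrow> nat \<Rightarrow> bool" where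
  "idfam e n \<longleftrightarrow> (\<forall>i. idem (e i)) \<and> (\<forall>i\<ge>n. e i = \<zero>)"

lemma idfam_carrier: "idfam e n \<Longrightarrow> e i \<in> carrier R"
  by (simp add: idfam_def idemD)

text \<open>Refining \<open>A \<oplus> B = R^n \<oplus> R\<close> gives
  \<open>A = Z11 \<oplus> Z12\<close> with \<open>Z11\<close> a summand of \<open>R^n\<close> and
  \<open>Z12\<close> a summand of \<open>R\<close>. The induction hypothesis treats
  \<open>Z11\<close>, the rank one case treats \<open>Z12\<close>. The complement changes from
  \<open>B\<close> to \<open>Z21\<close>, so the induction must range over both modules.\<close>

lemma summand_iso_idmod:
  fixes A B :: "('a, nat \<Rightarrow> 'a) module"
  assumes "refinement_ring R"
  shows "fg_projective R A \<Longrightarrow> fg_projective R B \<Longrightarrow> iso_mod R (dsum A B) (freemod R n) \<Longrightarrow>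
    \<exists>e. idfam e n \<and> iso_mod R A (idmod e)"
proof (induction n arbitrary: A B)
  case 0
  note A = fg_projective_module[OF 0(1)] and B = fg_projective_module[OF 0(2)]
  interpret A: module R A by (rule A)
  interpret B: module R B by (rule B)
  have zero: "v = (\<lambda>_. \<zero>)" if "v \<in> carrier (freemod R 0)" for v
    using that by (auto simp: freemod_def)
  obtain h k where h: "\<And>x. x \<in> carrier (dsum A B) \<Longrightarrow> h x \<in> carrier (freemod R 0)"
    and kh: "\<And>x. x \<in> carrier (dsum A B) \<Longrightarrow> k (h x) = x"
    by (rule iso_modE[OF 0(3)]) (rule that; (assumption | blast))
  \<comment> \<open>\<open>A\<close> embeds into \<open>R^0\<close>, whose only element is the zero
    vector, so all elements of \<open>A\<close> have the same image and coincide.\<close>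
  have triv: "x = \<zero>\<^bsub>A\<^esub>" if "x \<in> carrier A" for x
  proof -
    have "(x, \<zero>\<^bsub>B\<^esub>) \<in> carrier (dsum A B)" "(\<zero>\<^bsub>A\<^esub>, \<zero>\<^bsub>B\<^esub>) \<in> carrier (dsum A B)"
      using that by auto
    note * = zero[OF h[OF this(1)]] zero[OF h[OF this(2)]] kh[OF this(1)] kh[OF this(2)]
    have "(x, \<zero>\<^bsub>B\<^esub>) = (\<zero>\<^bsub>A\<^esub>, \<zero>\<^bsub>B\<^esub>)" using * by simp
    then show ?thesis by simp
  qed
  have "iso_mod R A (freemod R 0)"
  proof (rule iso_modI[where h = "\<lambda>_ _. \<zero>" and k = "\<lambda>_. \<zero>\<^bsub>A\<^esub>"])
    show "\<zero>\<^bsub>A\<^esub> = x" if "x \<in> carrier A" for x using triv[OF that] by simp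
    show "(\<lambda>_. \<zero>) = v" if "v \<in> carrier (freemod R 0)" for v using zero[OF that] by simp
  qed (simp_all add: A module_freemod, simp_all add: freemod_def)
  then show ?case
    by (intro exI[of _ "\<lambda>_. \<zero>"]) (simp add: freemod_eq_idmod idfam_def)
next
  case (Suc n)
  have "iso_mod R (dsum A B) (dsum (freemod R n) (freemod R 1))"
    using Suc.prems(3) freemod_Suc by (rule iso_mod_trans)
  note * = assms[unfolded refinement_ring_def, THEN spec, THEN spec, THEN spec, THEN spec, THEN mp,
      OF conjI[OF Suc.prems(1) conjI[OF Suc.prems(2)
        conjI[OF fg_projective_freemod conjI[OF fg_projective_freemod this]]]]]
  obtain Z11 Z12 Z21 Z22 :: "('a, nat \<Rightarrow> 'a) module"
    where Z: "fg_projective R Z11" "fg_projective R Z12" "fg_projective R Z21" "fg_projective R Z22"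
      and A: "iso_mod R A (dsum Z11 Z12)"
      and n: "iso_mod R (freemod R n) (dsum Z11 Z21)"
      and one: "iso_mod R (freemod R 1) (dsum Z12 Z22)"
    using * by (elim exE conjE) (rule that)
  obtain e where e: "idfam e n" "iso_mod R Z11 (idmod e)"
    using Suc.IH[OF Z(1,3) iso_mod_sym[OF n]] by blast
  obtain c where c: "idem c" "iso_mod R Z12 (idmod ((\<lambda>_. \<zero>)(0 := c)))"
    using rank_one_summand[OF one] Z fg_projective_module by metis
  \<comment> \<open>The ideal \<open>c R\<close> goes into slot \<open>n\<close>, the first slot
    that the family for \<open>Z11\<close> is known to leave empty.\<close>
  have "iso_mod R (dsum Z11 Z12) (idmod (e(n := c)))"
    using iso_mod_dsum_cong[OF e(2) c(2)]
    by (rule iso_mod_trans)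
      (use e(1) c(1) in \<open>auto intro!: idmod_add_one idemD(1) simp: idfam_def\<close>)
  with A have "iso_mod R A (idmod (e(n := c)))" by (rule iso_mod_trans)
  moreover have "idfam (e(n := c)) (Suc n)" using e(1) c(1) by (auto simp: idfam_def)
  ultimately show ?case by blast
qed

text \<open>\<open>M\<close> may have any carrier type, whereas the refinement property speaks of
  one fixed type. Hence \<open>M\<close> is replaced by the isomorphic summand \<open>P\<close> of
  \<open>R^n\<close>, with \<open>Q\<close> as complement.\<close>

lemma fg_projective_iso_idmod:
  assumes "refinement_ring R" "fg_projective R M"
  obtains e n where "idfam e n" "iso_mod R M (idmod e)"
proof -
  from assms(2) obtain n P Q
    where PQ: "submodule P R (freemod R n)" "submodule Q R (freemod R n)"
      "P \<inter> Q = {\<zero>\<^bsub>freemod R n\<^esub>}"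
      "\<forall>v\<in>carrier (freemod R n). \<exists>p\<in>P. \<exists>q\<in>Q. v = p \<oplus>\<^bsub>freemod R n\<^esub> q"
      and M: "iso_mod R M ((freemod R n)\<lparr>carrier := P\<rparr>)"
    unfolding fg_projective_def by (elim exE conjE) (rule that)
  interpret F: module R "freemod R n" by (rule module_freemod)
  \<comment> \<open>With the summands exchanged, \<open>Q\<close> itself is seen to be projective,
    with complement \<open>P\<close>; refinement requires this of both summands.\<close>
  have "\<forall>v\<in>carrier (freemod R n). \<exists>q\<in>Q. \<exists>p\<in>P. v = q \<oplus>\<^bsub>freemod R n\<^esub> p"
  proof
    fix v assume "v \<in> carrier (freemod R n)"
    then obtain p q where pq: "p \<in> P" "q \<in> Q" "v = p \<oplus>\<^bsub>freemod R n\<^esub> q" using PQ(4) by blast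
    then have "v = q \<oplus>\<^bsub>freemod R n\<^esub> p"
      using F.submoduleE(1)[OF PQ(1)] F.submoduleE(1)[OF PQ(2)] F.M.a_comm by blast
    with pq show "\<exists>q\<in>Q. \<exists>p\<in>P. v = q \<oplus>\<^bsub>freemod R n\<^esub> p" by blast
  qed
  then have "fg_projective R ((freemod R n)\<lparr>carrier := Q\<rparr>)"
    using PQ by (intro summand_fg_projective[where Q = P]) auto
  then have "\<exists>e. idfam e n \<and> iso_mod R ((freemod R n)\<lparr>carrier := P\<rparr>) (idmod e)"
    by (rule summand_iso_idmod[OF assms(1) summand_fg_projective[OF PQ] _
          internal_direct_sum[OF module_freemod PQ]])
  with M that show thesis by (blast intro: iso_mod_trans)
qed

end

section \<open>Classification by ranks at prime ideals\<close>

context plain_cring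
begin

section \<open>Prime ideals avoiding a nonzero idempotent\<close>

lemma ideal_Union_chain:
  assumes "C \<noteq> {}" "\<And>I. I \<in> C \<Longrightarrow> ideal I R" "\<And>I J. I \<in> C \<Longrightarrow> J \<in> C \<Longrightarrow> I \<subseteq> J \<or> J \<subseteq> I"
  shows "ideal (\<Union>C) R"
proof (rule idealI)
  show "ring R" by (rule ring_axioms)
  have sub: "additive_subgroup I R" if "I \<in> C" for I
    using assms(2)[OF that] by (rule ideal.axioms)
  show "subgroup (\<Union>C) (add_monoid R)"
  proof (rule add.subgroupI)
    show "\<Union>C \<subseteq> carrier R"
      using additive_subgroup.a_subset[OF sub] by blast
    show "\<Union>C \<noteq> {}"
      using assms(1) additive_subgroup.zero_closed[OF sub] by blast
    show "\<ominus> a \<in> \<Union>C" if "a \<in> \<Union>C" for a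
      using that additive_subgroup.a_inv_closed[OF sub] by blast
    fix a b assume "a \<in> \<Union>C" "b \<in> \<Union>C"
    then obtain I J where IJ: "I \<in> C" "a \<in> I" "J \<in> C" "b \<in> J" by blast
    show "a \<oplus> b \<in> \<Union>C"
    proof (cases "I \<subseteq> J")
      case True
      then show ?thesis using IJ additive_subgroup.a_closed[OF sub[OF IJ(3)]] by blast
    next
      case False
      then have "J \<subseteq> I" using assms(3) IJ by blast
      then show ?thesis using IJ additive_subgroup.a_closed[OF sub[OF IJ(1)]] by blast
    qed
  qed
  show "x \<otimes> a \<in> \<Union>C" "a \<otimes> x \<in> \<Union>C" if "a \<in> \<Union>C" "x \<in> carrier R" for a x
    using that ideal.I_l_closed[OF assms(2)] ideal.I_r_closed[OF assms(2)] by blast+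
qed

text \<open>By Zorn there is an ideal \<open>J\<close> maximal among those not containing
  \<open>g\<close>; the zero ideal is one of them. If \<open>a\<close> and \<open>b\<close> lie
  outside \<open>J\<close>, then \<open>g\<close> lies in \<open>J + a R\<close> and in
  \<open>J + b R\<close>. As \<open>g\<close> is idempotent, multiplying the two representations
  puts \<open>g\<close> into \<open>J + a b R\<close>, so \<open>a b\<close> is not in
  \<open>J\<close>.\<close>

lemma primeideal_avoiding_idem:
  assumes "idem g" "g \<noteq> \<zero>"
  obtains P where "primeideal P R" "g \<notin> P"
proof -
  note g = idemD[OF assms(1)]
  define A where "A = {I. ideal I R \<and> g \<notin> I}"
  have "\<exists>J\<in>A. \<forall>I\<in>A. J \<subseteq> I \<longrightarrow> I = J"
  proof (rule subset_Zorn_nonempty)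
    show "A \<noteq> {}" using zeroideal assms(2) by (auto simp: A_def)
    fix C assume "C \<noteq> {}" "subset.chain A C"
    then show "\<Union>C \<in> A"
      using ideal_Union_chain[of C] by (auto simp: A_def subset_chain_def)
  qed
  then obtain J where J: "ideal J R" "g \<notin> J" and
    J_max: "\<And>I. ideal I R \<Longrightarrow> J \<subseteq> I \<Longrightarrow> g \<notin> I \<Longrightarrow> I = J"
    by (auto simp: A_def)
  interpret J: ideal J R by fact
  have reach: "\<exists>j\<in>J. \<exists>r\<in>carrier R. g = j \<oplus> r \<otimes> a" if "a \<in> carrier R" "a \<notin> J" for a
  proof -
    let ?K = "J <+>\<^bsub>R\<^esub> PIdl a"
    have "ideal ?K R" using J(1) cgenideal_ideal[OF that(1)] by (rule add_ideals)
    moreover have "\<zero> \<in> PIdl a"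
      using that(1) unfolding cgenideal_def by (auto intro: exI[of _ \<zero>])
    then have "J \<subseteq> ?K"
      unfolding set_add_def' using J.a_subset by (force intro: bexI[of _ \<zero>])
    moreover have "a = \<zero> \<oplus> a" using that(1) by simp
    then have "a \<in> ?K"
      unfolding set_add_def' using cgenideal_self[OF that(1)] J.zero_closed by blast
    ultimately have "g \<in> ?K" using J_max[of ?K] that(2) by blast
    then show ?thesis unfolding set_add_def' cgenideal_def by blast
  qed
  have "primeideal J R"
  proof (rule primeidealI)
    show "carrier R \<noteq> J" using g J(2) by blast
    fix a b assume ab: "a \<in> carrier R" "b \<in> carrier R" "a \<otimes> b \<in> J"
    show "a \<in> J \<or> b \<in> J"
    proof (rule ccontr)
      assume "\<not> (a \<in> J \<or> b \<in> J)"
      then obtain j r k s where *: "j \<in> J" "r \<in> carrier R" "g = j \<oplus> r \<otimes> a"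
        "k \<in> J" "s \<in> carrier R" "g = k \<oplus> s \<otimes> b"
        using reach ab by meson
      note jk = J.a_Hcarr[OF *(1)] J.a_Hcarr[OF *(4)]
      \<comment> \<open>Idempotence of \<open>g\<close> enters here: it is the product of its two
        representations. After expansion every term has a factor \<open>j\<close>, \<open>k\<close>
        or \<open>a \<otimes> b\<close>, all in \<open>J\<close>.\<close>
      have "g = (j \<oplus> r \<otimes> a) \<otimes> (k \<oplus> s \<otimes> b)" using g *(3,6) by simp
      also have "\<dots> = j \<otimes> (k \<oplus> s \<otimes> b) \<oplus> ((r \<otimes> a) \<otimes> k \<oplus> (r \<otimes> s) \<otimes> (a \<otimes> b))"
        using ab(1,2) *(2,5) jk by algebra
      also have "\<dots> \<in> J"
        using ab * jk
        by (intro J.a_closed J.I_r_closed[OF *(1)] J.I_l_closed[OF *(4)] J.I_l_closed[OF ab(3)]) auto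
      finally show False using J(2) by simp
    qed
  qed (use J is_cring in auto)
  with J(2) that show thesis by blast
qed

text \<open>Gaussian elimination: the relation \<open>L\<close> plays the role of the graph of a linear map, its
  first components contain \<open>I\<close>-many vectors independent modulo \<open>P\<close>, and \<open>J\<close> indexes the
  remaining coordinates of the image.\<close>

lemma exists_kernel_vector:
  fixes L :: "((nat \<Rightarrow> 'a) \<times> (nat \<Rightarrow> 'a)) set"
  assumes P: "primeideal P R"
  shows "finite J \<Longrightarrow> finite I \<Longrightarrow> card J < card I \<Longrightarrow>
    (\<And>v w i. (v, w) \<in> L \<Longrightarrow> v i \<in> carrier R \<and> w i \<in> carrier R) \<Longrightarrow>
    (\<And>v w v' w' p q. (v, w) \<in> L \<Longrightarrow> (v', w') \<in> L \<Longrightarrow> p \<in> carrier R \<Longrightarrow> q \<in> carrier R \<Longrightarrow>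
      (\<lambda>i. p \<otimes> v i \<ominus> q \<otimes> v' i, \<lambda>i. p \<otimes> w i \<ominus> q \<otimes> w' i) \<in> L) \<Longrightarrow>
    (\<And>i. i \<in> I \<Longrightarrow> (b i, c i) \<in> L) \<Longrightarrow> (\<And>i. i \<in> I \<Longrightarrow> b i i \<notin> P) \<Longrightarrow>
    (\<And>i k. i \<in> I \<Longrightarrow> k \<in> I \<Longrightarrow> i \<noteq> k \<Longrightarrow> b i k \<in> P) \<Longrightarrow>
    \<exists>(v, w)\<in>L. (\<exists>i\<in>I. v i \<notin> P) \<and> (\<forall>j\<in>J. w j \<in> P)"
proof (induction J arbitrary: I L b c rule: finite_induct)
  case (empty I L x y)
  then obtain i where i: "i \<in> I" by fastforce
  have "(x i, y i) \<in> L" "x i i \<notin> P" using empty.prems(5,6) i by auto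
  with i show ?case by blast
next
  case (insert j J I L x y)
  interpret P: primeideal P R by (rule P)
  have diff: "a \<ominus> b \<in> P" if "a \<in> P" "b \<in> P" for a b
    using that by (simp add: minus_eq)
  note carr = insert.prems(3) and comb = insert.prems(4) and mem = insert.prems(5)
    and diag = insert.prems(6) and offdiag = insert.prems(7)
  \<comment> \<open>The condition for the coordinate \<open>j\<close> is built into the relation,
    which leaves only the coordinates in \<open>J\<close> to the induction hypothesis.\<close>
  define L' where "L' = {(v, w)\<in>L. w j \<in> P}"
  have carr': "v i \<in> carrier R \<and> w i \<in> carrier R" if "(v, w) \<in> L'" for v w i
    using that carr[of v w i] by (simp add: L'_def)
  have comb': "(\<lambda>i. p \<otimes> v i \<ominus> q \<otimes> v' i, \<lambda>i. p \<otimes> w i \<ominus> q \<otimes> w' i) \<in> L'"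
    if "(v, w) \<in> L'" "(v', w') \<in> L'" "p \<in> carrier R" "q \<in> carrier R" for v w v' w' p q
    using that comb[of v w v' w' p q] by (simp add: L'_def diff P.I_l_closed)
  have "\<exists>(v, w)\<in>L'. (\<exists>i\<in>I. v i \<notin> P) \<and> (\<forall>j\<in>J. w j \<in> P)"
  \<comment> \<open>A pivot is an image whose coordinate \<open>j\<close> lies outside
    \<open>P\<close>. If there is none, all given pairs already belong to \<open>L'\<close>.\<close>
  proof (cases "\<forall>i\<in>I. y i j \<in> P")
    case True
    show ?thesis
    proof (rule insert.IH[of I L' x y])
      show "finite I" by (rule insert.prems(1))
      show "card J < card I" using insert.prems(2) insert.hyps by simp
      show "(x i, y i) \<in> L'" if "i \<in> I" for i
        using mem[OF that] True that by (simp add: L'_def)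
    qed (fact carr' comb' diag offdiag)+
  next
    case False
    then obtain k where k: "k \<in> I" "y k j \<notin> P" by blast
    \<comment> \<open>Cross-multiplication with the pivot row \<open>k\<close>: the coordinate
      \<open>j\<close> of the image,
      \<open>y k j \<otimes> y i j \<ominus> y i j \<otimes> y k j\<close>, vanishes, and nothing is
      divided by the pivot.\<close>
    define x' where "x' i = (\<lambda>l. y k j \<otimes> x i l \<ominus> y i j \<otimes> x k l)" for i
    define y' where "y' i = (\<lambda>l. y k j \<otimes> y i l \<ominus> y i j \<otimes> y k l)" for i
    have x: "x i l \<in> carrier R" "y i l \<in> carrier R" if "i \<in> I" for i l
      using carr[OF mem[OF that]] by auto
    have mem': "(x' i, y' i) \<in> L'" if "i \<in> I" for i
    proof -
      have "y' i j = \<zero>"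
        using x[OF k(1), of j] x[OF that, of j] by (simp add: y'_def m_comm minus_eq r_neg)
      moreover have "(x' i, y' i) \<in> L"
        using comb[OF mem[OF that] mem[OF k(1)] x(2)[OF k(1)] x(2)[OF that]]
        by (simp add: x'_def y'_def)
      ultimately show ?thesis by (simp add: L'_def)
    qed
    \<comment> \<open>Removing the coordinate \<open>j\<close> costs only the pivot vector, so the
      strict inequality of cardinalities survives.\<close>
    have "\<exists>(v, w)\<in>L'. (\<exists>i\<in>I - {k}. v i \<notin> P) \<and> (\<forall>j\<in>J. w j \<in> P)"
    proof (rule insert.IH[of "I - {k}" L' x' y'])
      show "finite (I - {k})" using insert.prems(1) by simp
      show "card J < card (I - {k})" using insert.prems(1,2) insert.hyps k(1) by simp
      fix i assume i: "i \<in> I - {k}"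
      show "(x' i, y' i) \<in> L'" using mem' i by blast
      \<comment> \<open>Modulo \<open>P\<close> the diagonal entry is merely scaled: the subtracted
        term contains the off-diagonal entry \<open>x k i\<close>, which lies in \<open>P\<close>.
        The scaling factor \<open>y k j\<close> and the old entry are outside \<open>P\<close>,
        hence so is their product.\<close>
      show "x' i i \<notin> P"
      proof
        assume "x' i i \<in> P"
        moreover have "y i j \<otimes> x k i \<in> P"
          using x i k offdiag[of k i] by (auto intro: P.I_l_closed)
        ultimately have "x' i i \<oplus> y i j \<otimes> x k i \<in> P" by simp
        also have "x' i i \<oplus> y i j \<otimes> x k i = y k j \<otimes> x i i"
        proof -
          have "x i i \<in> carrier R" "y k j \<in> carrier R" "y i j \<in> carrier R" "x k i \<in> carrier R"
            using x i k by auto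
          then show ?thesis unfolding x'_def by algebra
        qed
        finally show False using P.I_prime[of "y k j" "x i i"] k diag[of i] i x by auto
      qed
      fix l assume l: "l \<in> I - {k}" "i \<noteq> l"
      show "x' i l \<in> P" unfolding x'_def
        using x i l k offdiag[of i l] offdiag[of k l] by (intro diff P.I_l_closed) auto
    qed (fact carr' comb')+
    then show ?thesis by blast
  qed
  then show ?case by (auto simp: L'_def)
qed

text \<open>A family with values in \<open>{\<zero>, g}\<close> is determined by its support. Finite
  supports of equal size are in bijection, and slots can be permuted; without finiteness
  \<open>card\<close> would say nothing about a bijection.\<close>

lemma idmod_iso_if_card_eq:
  assumes I: "idem g" "\<And>i. a i \<in> {\<zero>, g}" "\<And>i. b i \<in> {\<zero>, g}"
    and fin: "finite {i. a i \<noteq> \<zero>}" "finite {i. b i \<noteq> \<zero>}"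
    and card: "card {i. a i \<noteq> \<zero>} = card {i. b i \<noteq> \<zero>}"
  shows "iso_mod R (idmod a) (idmod b)"
proof -
  have eq: "c = (\<lambda>i. if i \<in> {i. c i \<noteq> \<zero>} then g else \<zero>)" if "\<And>i. c i \<in> {\<zero>, g}" for c :: "nat \<Rightarrow> 'a"
    using that by (auto simp: fun_eq_iff)
  obtain s where s: "bij_betw s {i. b i \<noteq> \<zero>} {i. a i \<noteq> \<zero>}"
    using finite_same_card_bij[OF fin(2,1)] card by auto
  show ?thesis
    using idmod_reindex[OF s idemD(1)[OF I(1)]]
    unfolding eq[OF I(2), symmetric] eq[OF I(3), symmetric] .
qed

lemma idfam_finite: "idfam a n \<Longrightarrow> finite {i. a i \<noteq> \<zero>}"
  by (rule finite_subset[of _ "{..<n}"]) (auto simp: idfam_def, meson leI)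

text \<open>Both sides are free over the corner \<open>g R\<close>. For a prime \<open>P\<close>
  avoiding \<open>g\<close>, the product \<open>g \<otimes> a i\<close> is nonzero exactly when
  \<open>a i\<close> is outside \<open>P\<close>, so the rank at this one \<open>P\<close> counts
  the summands. If \<open>g = \<zero>\<close>, both modules vanish.\<close>

lemma idmod_iso_atom:
  assumes a: "idfam a n" and b: "idfam b m" and g: "idem g"
    and rank: "\<And>P. primeideal P R \<Longrightarrow> card {i. a i \<notin> P} = card {i. b i \<notin> P}"
    and "\<And>i. g \<otimes> a i \<in> {\<zero>, g}" "\<And>i. g \<otimes> b i \<in> {\<zero>, g}"
  shows "iso_mod R (idmod (\<lambda>i. g \<otimes> a i)) (idmod (\<lambda>i. g \<otimes> b i))"
proof (cases "g = \<zero>")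
  case True
  then have "(\<lambda>i. g \<otimes> a i) = (\<lambda>_. \<zero>)" "(\<lambda>i. g \<otimes> b i) = (\<lambda>_. \<zero>)"
    using idfam_carrier[OF a] idfam_carrier[OF b] by auto
  then show ?thesis by (simp add: iso_mod_refl module_idmod)
next
  case False
  obtain P where P: "primeideal P R" "g \<notin> P" using primeideal_avoiding_idem[OF g False] .
  interpret P: primeideal P R by (rule P(1))
  have gc: "g \<in> carrier R" by (rule idemD(1)[OF g])
  have supp: "{i. g \<otimes> c i \<noteq> \<zero>} = {i. c i \<notin> P}"
    if "\<And>i. c i \<in> carrier R" "\<And>i. g \<otimes> c i \<in> {\<zero>, g}" for c :: "nat \<Rightarrow> 'a"
  proof -
    have "g \<otimes> c i \<noteq> \<zero> \<longleftrightarrow> c i \<notin> P" for i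
    proof
      assume "g \<otimes> c i \<noteq> \<zero>"
      then have "g \<otimes> c i = g" using that(2)[of i] by simp
      then show "c i \<notin> P" using P(2) P.I_l_closed[of "c i" g] gc by auto
    next
      assume "c i \<notin> P"
      then show "g \<otimes> c i \<noteq> \<zero>"
        using P.I_prime[OF gc that(1)[of i]] P(2) P.zero_closed by auto
    qed
    then show ?thesis by auto
  qed
  have fin: "finite {i. g \<otimes> c i \<noteq> \<zero>}" if "idfam c l" for c l
    by (rule finite_subset[OF _ idfam_finite[OF that]]) (use gc in auto)
  show ?thesis
    by (rule idmod_iso_if_card_eq[OF g assms(5,6) fin[OF a] fin[OF b]])
      (use supp[OF idfam_carrier[OF a] assms(5)] supp[OF idfam_carrier[OF b] assms(6)]
        rank[OF P(1)] in simp)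
qed

text \<open>\<open>T\<close> holds the idempotents not yet decided on the piece \<open>g\<close>,
  where \<open>t\<close> counts as decided if \<open>g \<otimes> t\<close> is \<open>\<zero>\<close>
  or \<open>g\<close>. Splitting by \<open>t\<close> and \<open>\<one> \<ominus> t\<close> decides
  \<open>t\<close> on both halves. The families stay fixed and only \<open>g\<close> shrinks, so the
  rank hypothesis is passed on unchanged.\<close>

lemma idmod_iso_idem:
  assumes a: "idfam a n" and b: "idfam b m"
    and rank: "\<And>P. primeideal P R \<Longrightarrow> card {i. a i \<notin> P} = card {i. b i \<notin> P}"
    and "finite T"
  shows "idem g \<Longrightarrow> (\<And>t. t \<in> T \<Longrightarrow> idem t) \<Longrightarrow>
    (\<And>i. a i \<in> T \<or> g \<otimes> a i \<in> {\<zero>, g}) \<Longrightarrow> (\<And>i. b i \<in> T \<or> g \<otimes> b i \<in> {\<zero>, g}) \<Longrightarrow>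
    iso_mod R (idmod (\<lambda>i. g \<otimes> a i)) (idmod (\<lambda>i. g \<otimes> b i))"
  using assms(4)
proof (induction T arbitrary: g rule: finite_induct)
  case empty
  then show ?case by (intro idmod_iso_atom[OF a b _ rank]) auto
next
  case (insert t T)
  note ac = idfam_carrier[OF a] and bc = idfam_carrier[OF b]
  have t: "idem t" using insert.prems(2) by simp
  have step: "iso_mod R (idmod (\<lambda>i. h \<otimes> (g \<otimes> a i))) (idmod (\<lambda>i. h \<otimes> (g \<otimes> b i)))"
    if h: "idem h" and ht: "h \<otimes> t \<in> {\<zero>, h}" for h
  proof -
    have c: "h \<in> carrier R" "g \<in> carrier R" "t \<in> carrier R"
      using idemD(1) h insert.prems(1) t by auto
    \<comment> \<open>What is decided on \<open>g\<close> remains decided on the smaller piece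
      \<open>h \<otimes> g\<close>; the fact \<open>2\<close> adds \<open>t\<close> itself.\<close>
    have 1: "h \<otimes> g \<otimes> x \<in> {\<zero>, h \<otimes> g}" if "g \<otimes> x \<in> {\<zero>, g}" "x \<in> carrier R" for x
      using that c by (auto simp: m_assoc)
    have "h \<otimes> g \<otimes> t = h \<otimes> t \<otimes> g" using c by algebra
    then have 2: "h \<otimes> g \<otimes> t \<in> {\<zero>, h \<otimes> g}" using ht c by auto
    have "iso_mod R (idmod (\<lambda>i. h \<otimes> g \<otimes> a i)) (idmod (\<lambda>i. h \<otimes> g \<otimes> b i))"
    proof (rule insert.IH)
      show "idem (h \<otimes> g)" using idem_mult h insert.prems(1) by blast
      show "a i \<in> T \<or> h \<otimes> g \<otimes> a i \<in> {\<zero>, h \<otimes> g}" for i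
        using insert.prems(3)[of i] 1[OF _ ac] 2 by auto
      show "b i \<in> T \<or> h \<otimes> g \<otimes> b i \<in> {\<zero>, h \<otimes> g}" for i
        using insert.prems(4)[of i] 1[OF _ bc] 2 by auto
    qed (use insert.prems in auto)
    then show ?thesis using c ac bc by (simp add: m_assoc)
  qed
  have gc: "g \<in> carrier R" using insert.prems(1) by (rule idemD)
  have "iso_mod R (idmod (\<lambda>i. g \<otimes> a i))
      (dsum (idmod (\<lambda>i. t \<otimes> (g \<otimes> a i))) (idmod (\<lambda>i. (\<one> \<ominus> t) \<otimes> (g \<otimes> a i))))"
    using ac gc t by (intro idmod_split) auto
  also have "iso_mod R \<dots> (dsum (idmod (\<lambda>i. t \<otimes> (g \<otimes> b i))) (idmod (\<lambda>i. (\<one> \<ominus> t) \<otimes> (g \<otimes> b i))))"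
    by (intro iso_mod_dsum_cong step) (use t idem_compl idem_compl_mult idemD in auto)
  also have "iso_mod R \<dots> (idmod (\<lambda>i. g \<otimes> b i))"
    using bc gc t by (intro iso_mod_sym[OF idmod_split]) auto
  finally show ?case .
qed

lemma idmod_iso_if_rank_eq:
  assumes a: "idfam a n" and b: "idfam b m"
    and rank: "\<And>P. primeideal P R \<Longrightarrow> card {i. a i \<notin> P} = card {i. b i \<notin> P}"
  shows "iso_mod R (idmod a) (idmod b)"
proof -
  have "iso_mod R (idmod (\<lambda>i. \<one> \<otimes> a i)) (idmod (\<lambda>i. \<one> \<otimes> b i))"
  proof (rule idmod_iso_idem[OF a b rank])
    \<comment> \<open>At \<open>g = \<one>\<close> all values in slots below the bounds are treated
      as undecided; beyond the bounds the values are zero, hence decided.\<close>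
    show "finite (a ` {..<n} \<union> b ` {..<m})" by simp
    show "idem t" if "t \<in> a ` {..<n} \<union> b ` {..<m}" for t
      using that a b by (auto simp: idfam_def)
    show "a i \<in> a ` {..<n} \<union> b ` {..<m} \<or> \<one> \<otimes> a i \<in> {\<zero>, \<one>}" for i
      using a by (cases "i < n") (auto simp: idfam_def)
    show "b i \<in> a ` {..<n} \<union> b ` {..<m} \<or> \<one> \<otimes> b i \<in> {\<zero>, \<one>}" for i
      using b by (cases "i < m") (auto simp: idfam_def)
  qed simp_all
  then show ?thesis using idfam_carrier[OF a] idfam_carrier[OF b] by simp
qed

end

section \<open>Localization at an element\<close>

lemma self_mod_simps [simp]:
  "carrier (self_mod R) = carrier R" "\<zero>\<^bsub>self_mod R\<^esub> = \<zero>\<^bsub>R\<^esub>"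
  "a \<oplus>\<^bsub>self_mod R\<^esub> b = a \<oplus>\<^bsub>R\<^esub> b" "a \<odot>\<^bsub>self_mod R\<^esub> b = a \<otimes>\<^bsub>R\<^esub> b"
  by (simp_all add: self_mod_def)

lemma (in plain_cring) module_self_mod: "module R (self_mod R)"
proof (rule moduleI)
  show "abelian_group (self_mod R)"
  proof (rule abelian_groupI)
    show "\<exists>y\<in>carrier (self_mod R). y \<oplus>\<^bsub>self_mod R\<^esub> a = \<zero>\<^bsub>self_mod R\<^esub>"
      if "a \<in> carrier (self_mod R)" for a
      using that by (intro bexI[of _ "\<ominus> a"]) (auto simp: l_neg)
  qed (auto simp: a_ac)
qed (auto simp: l_distr r_distr m_assoc is_cring)

locale localized_cring = plain_cring R for R :: "'a ring" (structure) +
  fixes x :: 'a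
  assumes x_closed [simp]: "x \<in> carrier R"
begin

text \<open>The class of \<open>m / x^k\<close>. It is empty when \<open>m\<close> is outside the
  carrier, since \<open>loc_rel\<close> relates carrier elements only.\<close>

definition frac :: "('a, 'b) module \<Rightarrow> 'b \<Rightarrow> nat \<Rightarrow> ('b \<times> nat) set" where
  "frac M m k = loc_rel R M x `` {(m, k)}"

abbreviation rfrac :: "'a \<Rightarrow> nat \<Rightarrow> ('a \<times> nat) set" where
  "rfrac \<equiv> frac (self_mod R)"

lemma pow_smult [simp]:
  assumes "module R M" "m \<in> carrier M"
  shows "x [^] (p::nat) \<odot>\<^bsub>M\<^esub> (x [^] (q::nat) \<odot>\<^bsub>M\<^esub> m) = x [^] (p + q) \<odot>\<^bsub>M\<^esub> m"
proof -
  interpret M: module R M by fact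
  show ?thesis using assms(2) by (simp add: M.smult_assoc1[symmetric] nat_pow_mult)
qed

lemma loc_rel_iff:
  assumes "module R M"
  shows "((m, k), (n, l)) \<in> loc_rel R M x \<longleftrightarrow> m \<in> carrier M \<and> n \<in> carrier M \<and>
    (\<exists>j::nat. x [^] (j + l) \<odot>\<^bsub>M\<^esub> m = x [^] (j + k) \<odot>\<^bsub>M\<^esub> n)"
proof -
  interpret M: module R M by fact
  have "x [^] (j::nat) \<odot>\<^bsub>M\<^esub> (x [^] l \<odot>\<^bsub>M\<^esub> m \<ominus>\<^bsub>M\<^esub> x [^] k \<odot>\<^bsub>M\<^esub> n) = \<zero>\<^bsub>M\<^esub> \<longleftrightarrow>
      x [^] (j + l) \<odot>\<^bsub>M\<^esub> m = x [^] (j + k) \<odot>\<^bsub>M\<^esub> n"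
    if c: "m \<in> carrier M" "n \<in> carrier M" for j
  proof -
    let ?a = "x [^] (j + l) \<odot>\<^bsub>M\<^esub> m" and ?b = "x [^] (j + k) \<odot>\<^bsub>M\<^esub> n"
    have "x [^] (j::nat) \<odot>\<^bsub>M\<^esub> (x [^] l \<odot>\<^bsub>M\<^esub> m \<ominus>\<^bsub>M\<^esub> x [^] k \<odot>\<^bsub>M\<^esub> n) = ?a \<oplus>\<^bsub>M\<^esub> \<ominus>\<^bsub>M\<^esub> ?b"
      using c assms by (simp add: M.M.minus_eq M.smult_r_distr M.smult_r_minus)
    moreover have "?a \<oplus>\<^bsub>M\<^esub> \<ominus>\<^bsub>M\<^esub> ?b = \<zero>\<^bsub>M\<^esub> \<longleftrightarrow> ?a = ?b"
    proof
      assume "?a \<oplus>\<^bsub>M\<^esub> \<ominus>\<^bsub>M\<^esub> ?b = \<zero>\<^bsub>M\<^esub>"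
      then show "?a = ?b" using c M.M.minus_equality[of ?a "\<ominus>\<^bsub>M\<^esub> ?b"] by simp
    qed (use c in \<open>simp add: M.M.r_neg\<close>)
    ultimately show ?thesis by simp
  qed
  then show ?thesis unfolding loc_rel_def by auto
qed

lemma pow_smult_eq_mono:
  assumes "module R M" "m \<in> carrier M" "n \<in> carrier M"
    and "x [^] (a::nat) \<odot>\<^bsub>M\<^esub> m = x [^] (b::nat) \<odot>\<^bsub>M\<^esub> n"
  shows "x [^] (c + a) \<odot>\<^bsub>M\<^esub> m = x [^] (c + b) \<odot>\<^bsub>M\<^esub> n"
proof -
  have "x [^] c \<odot>\<^bsub>M\<^esub> (x [^] a \<odot>\<^bsub>M\<^esub> m) = x [^] c \<odot>\<^bsub>M\<^esub> (x [^] b \<odot>\<^bsub>M\<^esub> n)"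
    using assms(4) by simp
  then show ?thesis unfolding pow_smult[OF assms(1,2)] pow_smult[OF assms(1,3)] .
qed

lemma equiv_loc_rel:
  assumes "module R M"
  shows "equiv (carrier M \<times> UNIV) (loc_rel R M x)"
proof (rule equivI)
  show "loc_rel R M x \<subseteq> (carrier M \<times> UNIV) \<times> (carrier M \<times> UNIV)"
    by (auto simp: loc_rel_iff[OF assms])
  show "refl_on (carrier M \<times> UNIV) (loc_rel R M x)"
    by (auto simp: refl_on_def loc_rel_iff[OF assms])
  show "sym (loc_rel R M x)"
    by (rule symI) (auto simp: loc_rel_iff[OF assms], metis)
  show "trans (loc_rel R M x)"
  proof (rule transI, clarsimp simp: loc_rel_iff[OF assms])
    fix m k n l p q and i j :: nat
    assume c: "m \<in> carrier M" "n \<in> carrier M" "p \<in> carrier M"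
      and 1: "x [^] (j + l) \<odot>\<^bsub>M\<^esub> m = x [^] (j + k) \<odot>\<^bsub>M\<^esub> n"
      and 2: "x [^] (i + q) \<odot>\<^bsub>M\<^esub> n = x [^] (i + l) \<odot>\<^bsub>M\<^esub> p"
    \<comment> \<open>The first equation is multiplied by \<open>x^(i+q)\<close> and the second by
      \<open>x^(j+k)\<close>; both then contain the middle term
      \<open>x^(i+j+k+q) n\<close>.\<close>
    have "x [^] ((i + j + l) + q) \<odot>\<^bsub>M\<^esub> m = x [^] ((i + j + l) + k) \<odot>\<^bsub>M\<^esub> p"
      using pow_smult_eq_mono[OF assms c(1,2) 1, of "i + q"]
        pow_smult_eq_mono[OF assms c(2,3) 2, of "j + k"]
      by (simp add: ac_simps)
    then show "\<exists>j::nat. x [^] (j + q) \<odot>\<^bsub>M\<^esub> m = x [^] (j + k) \<odot>\<^bsub>M\<^esub> p" ..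
  qed
qed

lemma frac_eq_iff:
  assumes "module R M" "m \<in> carrier M" "n \<in> carrier M"
  shows "frac M m k = frac M n l \<longleftrightarrow>
    (\<exists>j::nat. x [^] (j + l) \<odot>\<^bsub>M\<^esub> m = x [^] (j + k) \<odot>\<^bsub>M\<^esub> n)"
  unfolding frac_def
  using eq_equiv_class_iff[OF equiv_loc_rel[OF assms(1)], of "(m, k)" "(n, l)"]
    loc_rel_iff[OF assms(1)] assms by simp

lemma mem_frac_iff:
  assumes "module R M"
  shows "(n, l) \<in> frac M m k \<longleftrightarrow> m \<in> carrier M \<and> n \<in> carrier M \<and> frac M n l = frac M m k"
  unfolding frac_def
  using equiv_class_eq_iff[OF equiv_loc_rel[OF assms]] by (auto simp: frac_def)

lemma frac_cancel:
  assumes "module R M" "m \<in> carrier M"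
  shows "frac M (x [^] (l::nat) \<odot>\<^bsub>M\<^esub> m) (l + k) = frac M m k"
proof -
  interpret M: module R M by fact
  show ?thesis using assms
    by (subst frac_eq_iff) (auto intro!: exI[of _ 0] simp: add.commute)
qed

lemma carrier_Mloc: "carrier (Mloc R M x) = {frac M m k | m k. m \<in> carrier M}"
  by (auto simp: Mloc_def Let_def quotient_def frac_def)

lemma Mloc_cases:
  assumes "C \<in> carrier (Mloc R M x)"
  obtains m k where "m \<in> carrier M" "C = frac M m k"
  using assms unfolding carrier_Mloc by blast

lemma frac_in_carrier [simp]: "m \<in> carrier M \<Longrightarrow> frac M m k \<in> carrier (Mloc R M x)"
  unfolding carrier_Mloc by blast

lemma zero_Mloc: "\<zero>\<^bsub>Mloc R M x\<^esub> = frac M \<zero>\<^bsub>M\<^esub> 0"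
  by (simp add: Mloc_def Let_def frac_def)

text \<open>Over a common denominator, addition of fractions is addition of numerators, so the group
  and module laws reduce to those of \<open>M\<close>.\<close>

lemma common_denominator2:
  assumes "module R M" "C \<in> carrier (Mloc R M x)" "D \<in> carrier (Mloc R M x)"
  obtains m n k where "m \<in> carrier M" "n \<in> carrier M" "C = frac M m k" "D = frac M n k"
proof -
  interpret M: module R M by fact
  obtain m k n l where "m \<in> carrier M" "C = frac M m k" "n \<in> carrier M" "D = frac M n l"
    using Mloc_cases[OF assms(2)] Mloc_cases[OF assms(3)] by metis
  then show thesis
    using that[of "x [^] l \<odot>\<^bsub>M\<^esub> m" "x [^] k \<odot>\<^bsub>M\<^esub> n" "l + k"] frac_cancel[OF assms(1), of m l k]
      frac_cancel[OF assms(1), of n k l] by (simp add: add.commute)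
qed

lemma common_denominator3:
  assumes "module R M" "C \<in> carrier (Mloc R M x)" "D \<in> carrier (Mloc R M x)"
    "E \<in> carrier (Mloc R M x)"
  obtains m n p k where "m \<in> carrier M" "n \<in> carrier M" "p \<in> carrier M"
    "C = frac M m k" "D = frac M n k" "E = frac M p k"
proof -
  interpret M: module R M by fact
  obtain m n k where "m \<in> carrier M" "n \<in> carrier M" "C = frac M m k" "D = frac M n k"
    by (rule common_denominator2[OF assms(1-3)])
  moreover obtain p l where "p \<in> carrier M" "E = frac M p l"
    by (rule Mloc_cases[OF assms(4)])
  ultimately show thesis
    using that[of "x [^] l \<odot>\<^bsub>M\<^esub> m" "x [^] l \<odot>\<^bsub>M\<^esub> n" "x [^] k \<odot>\<^bsub>M\<^esub> p" "l + k"]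
      frac_cancel[OF assms(1), of m l k] frac_cancel[OF assms(1), of n l k]
      frac_cancel[OF assms(1), of p k l] by (simp add: add.commute)
qed

text \<open>The sum is defined as a union over all representatives. Independence of the
  representatives turns the family being united into a singleton, whose union is the expected
  class.\<close>

lemma add_frac:
  assumes "module R M" "m \<in> carrier M" "n \<in> carrier M"
  shows "frac M m k \<oplus>\<^bsub>Mloc R M x\<^esub> frac M n l =
    frac M (x [^] l \<odot>\<^bsub>M\<^esub> m \<oplus>\<^bsub>M\<^esub> x [^] k \<odot>\<^bsub>M\<^esub> n) (k + l)" (is "_ = ?F")
proof -
  interpret M: module R M by fact
  have wd: "frac M (x [^] l' \<odot>\<^bsub>M\<^esub> m' \<oplus>\<^bsub>M\<^esub> x [^] k' \<odot>\<^bsub>M\<^esub> n') (k' + l') = ?F"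
    if "(m', k') \<in> frac M m k" "(n', l') \<in> frac M n l" for m' k' n' l'
  proof -
    from that have c: "m' \<in> carrier M" "n' \<in> carrier M"
      and eq: "frac M m' k' = frac M m k" "frac M n' l' = frac M n l"
      unfolding mem_frac_iff[OF assms(1)] by auto
    obtain i j :: nat where 1: "x [^] (i + k) \<odot>\<^bsub>M\<^esub> m' = x [^] (i + k') \<odot>\<^bsub>M\<^esub> m"
      and 2: "x [^] (j + l) \<odot>\<^bsub>M\<^esub> n' = x [^] (j + l') \<odot>\<^bsub>M\<^esub> n"
      using eq c assms by (auto simp: frac_eq_iff)
    show ?thesis
    proof (subst frac_eq_iff[OF assms(1)])
      \<comment> \<open>The exponent \<open>i + j\<close> serves both witnesses: each equation is
        multiplied by the remaining powers of \<open>x\<close>, and the two are added.\<close>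
      show "\<exists>p::nat. x [^] (p + (k + l)) \<odot>\<^bsub>M\<^esub> (x [^] l' \<odot>\<^bsub>M\<^esub> m' \<oplus>\<^bsub>M\<^esub> x [^] k' \<odot>\<^bsub>M\<^esub> n') =
        x [^] (p + (k' + l')) \<odot>\<^bsub>M\<^esub> (x [^] l \<odot>\<^bsub>M\<^esub> m \<oplus>\<^bsub>M\<^esub> x [^] k \<odot>\<^bsub>M\<^esub> n)"
        using pow_smult_eq_mono[OF assms(1) c(1) assms(2) 1, of "j + l + l'"]
          pow_smult_eq_mono[OF assms(1) c(2) assms(3) 2, of "i + k + k'"] c assms
        by (intro exI[of _ "i + j"]) (simp add: M.smult_r_distr ac_simps)
    qed (use c assms in auto)
  qed
  have mem: "(m, k) \<in> frac M m k" "(n, l) \<in> frac M n l"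
    using assms by (auto simp: mem_frac_iff)
  have "frac M m k \<oplus>\<^bsub>Mloc R M x\<^esub> frac M n l =
      \<Union>{frac M (x [^] l' \<odot>\<^bsub>M\<^esub> m' \<oplus>\<^bsub>M\<^esub> x [^] k' \<odot>\<^bsub>M\<^esub> n') (k' + l') | m' k' n' l'.
        (m', k') \<in> frac M m k \<and> (n', l') \<in> frac M n l}"
    by (simp add: Mloc_def Let_def frac_def)
  also have "{frac M (x [^] l' \<odot>\<^bsub>M\<^esub> m' \<oplus>\<^bsub>M\<^esub> x [^] k' \<odot>\<^bsub>M\<^esub> n') (k' + l') | m' k' n' l'.
        (m', k') \<in> frac M m k \<and> (n', l') \<in> frac M n l} = {?F}"
    using wd mem by blast
  finally show ?thesis by simp
qed

lemma add_frac_same: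
  assumes "module R M" "m \<in> carrier M" "n \<in> carrier M"
  shows "frac M m k \<oplus>\<^bsub>Mloc R M x\<^esub> frac M n k = frac M (m \<oplus>\<^bsub>M\<^esub> n) k"
proof -
  interpret M: module R M by fact
  show ?thesis
    using assms frac_cancel[OF assms(1), of "m \<oplus>\<^bsub>M\<^esub> n" k k]
    by (simp add: add_frac M.smult_r_distr)
qed

lemma smult_frac:
  assumes "module R M" "a \<in> carrier R" "m \<in> carrier M"
  shows "rfrac a k \<odot>\<^bsub>Mloc R M x\<^esub> frac M m l = frac M (a \<odot>\<^bsub>M\<^esub> m) (k + l)"
proof -
  interpret M: module R M by fact
  note S = module_self_mod
  have wd: "frac M (a' \<odot>\<^bsub>M\<^esub> m') (k' + l') = frac M (a \<odot>\<^bsub>M\<^esub> m) (k + l)"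
    if "(a', k') \<in> rfrac a k" "(m', l') \<in> frac M m l" for a' k' m' l'
  proof -
    from that have c: "a' \<in> carrier R" "m' \<in> carrier M"
      and eq: "rfrac a' k' = rfrac a k" "frac M m' l' = frac M m l"
      unfolding mem_frac_iff[OF assms(1)] mem_frac_iff[OF S] by auto
    obtain i j :: nat where 1: "x [^] (i + k) \<otimes> a' = x [^] (i + k') \<otimes> a"
      and 2: "x [^] (j + l) \<odot>\<^bsub>M\<^esub> m' = x [^] (j + l') \<odot>\<^bsub>M\<^esub> m"
      using eq c assms S by (auto simp: frac_eq_iff)
    \<comment> \<open>The power of \<open>x\<close> is distributed over the scalar and the vector,
      so that the witness \<open>i\<close> applies to the former and \<open>j\<close> to the
      latter.\<close>
    have mult: "x [^] ((i + j) + (p + q)) \<odot>\<^bsub>M\<^esub> (b \<odot>\<^bsub>M\<^esub> n) =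
        (x [^] (i + p) \<otimes> b) \<odot>\<^bsub>M\<^esub> (x [^] (j + q) \<odot>\<^bsub>M\<^esub> n)"
      if "b \<in> carrier R" "n \<in> carrier M" for b n and p q :: nat
    proof -
      have "x [^] ((i + j) + (p + q)) \<otimes> b = (x [^] (i + p) \<otimes> b) \<otimes> x [^] (j + q)"
        using that(1) by (simp add: nat_pow_mult[symmetric] m_ac)
      then show ?thesis using that by (simp add: M.smult_assoc1[symmetric])
    qed
    show ?thesis
      using c assms by (subst frac_eq_iff) (auto intro!: exI[of _ "i + j"] simp: mult 1 2)
  qed
  have mem: "(a, k) \<in> rfrac a k" "(m, l) \<in> frac M m l"
    using assms S by (auto simp: mem_frac_iff)
  have "rfrac a k \<odot>\<^bsub>Mloc R M x\<^esub> frac M m l =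
      \<Union>{frac M (a' \<odot>\<^bsub>M\<^esub> m') (k' + l') | a' k' m' l'.
        (a', k') \<in> rfrac a k \<and> (m', l') \<in> frac M m l}"
    by (simp add: Mloc_def Let_def frac_def)
  also have "{frac M (a' \<odot>\<^bsub>M\<^esub> m') (k' + l') | a' k' m' l'.
        (a', k') \<in> rfrac a k \<and> (m', l') \<in> frac M m l} = {frac M (a \<odot>\<^bsub>M\<^esub> m) (k + l)}"
    using wd mem by blast
  finally show ?thesis by simp
qed

lemma abelian_group_Mloc:
  assumes "module R M"
  shows "abelian_group (Mloc R M x)"
proof -
  interpret M: module R M by fact
  have zero: "\<zero>\<^bsub>Mloc R M x\<^esub> = frac M \<zero>\<^bsub>M\<^esub> k" for k
    using frac_cancel[OF assms, of "\<zero>\<^bsub>M\<^esub>" k 0] by (simp add: zero_Mloc)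
  note [simp] = add_frac_same[OF assms]
  show ?thesis
  proof (rule abelian_groupI)
    fix C D assume "C \<in> carrier (Mloc R M x)" "D \<in> carrier (Mloc R M x)"
    then obtain m n k where "m \<in> carrier M" "n \<in> carrier M" "C = frac M m k" "D = frac M n k"
      by (rule common_denominator2[OF assms])
    then show "C \<oplus>\<^bsub>Mloc R M x\<^esub> D \<in> carrier (Mloc R M x)"
      "C \<oplus>\<^bsub>Mloc R M x\<^esub> D = D \<oplus>\<^bsub>Mloc R M x\<^esub> C"
      by (simp_all add: M.M.a_comm)
  next
    fix C D E assume "C \<in> carrier (Mloc R M x)" "D \<in> carrier (Mloc R M x)" "E \<in> carrier (Mloc R M x)"
    then obtain m n p k where "m \<in> carrier M" "n \<in> carrier M" "p \<in> carrier M"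
      "C = frac M m k" "D = frac M n k" "E = frac M p k"
      by (rule common_denominator3[OF assms])
    then show "C \<oplus>\<^bsub>Mloc R M x\<^esub> D \<oplus>\<^bsub>Mloc R M x\<^esub> E = C \<oplus>\<^bsub>Mloc R M x\<^esub> (D \<oplus>\<^bsub>Mloc R M x\<^esub> E)"
      by (simp add: M.M.a_assoc)
  next
    fix C assume "C \<in> carrier (Mloc R M x)"
    then obtain m k where C: "m \<in> carrier M" "C = frac M m k" by (rule Mloc_cases)
    then show "\<zero>\<^bsub>Mloc R M x\<^esub> \<oplus>\<^bsub>Mloc R M x\<^esub> C = C" by (simp add: zero[of k])
    show "\<exists>D\<in>carrier (Mloc R M x). D \<oplus>\<^bsub>Mloc R M x\<^esub> C = \<zero>\<^bsub>Mloc R M x\<^esub>"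
      using C by (intro bexI[of _ "frac M (\<ominus>\<^bsub>M\<^esub> m) k"]) (auto simp: zero[of k] M.M.l_neg)
  qed (simp add: zero_Mloc)
qed

text \<open>The localized ring is the localization of \<open>R\<close> as a module over itself, with
  multiplication given by the scalar action. Its ring laws can thus be taken from the facts about
  localized modules.\<close>

lemma Rloc_simps:
  "carrier (Rloc R x) = carrier (Mloc R (self_mod R) x)"
  "\<zero>\<^bsub>Rloc R x\<^esub> = \<zero>\<^bsub>Mloc R (self_mod R) x\<^esub>"
  "C \<oplus>\<^bsub>Rloc R x\<^esub> D = C \<oplus>\<^bsub>Mloc R (self_mod R) x\<^esub> D"
  "C \<otimes>\<^bsub>Rloc R x\<^esub> D = C \<odot>\<^bsub>Mloc R (self_mod R) x\<^esub> D"
  "\<one>\<^bsub>Rloc R x\<^esub> = rfrac \<one> 0"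
  by (simp_all add: Rloc_def Mloc_def Let_def frac_def)

lemma cring_Rloc: "cring (Rloc R x)"
proof -
  note S = module_self_mod
  interpret A: abelian_group "Mloc R (self_mod R) x" by (rule abelian_group_Mloc[OF S])
  show ?thesis
  proof (rule cringI)
    show "abelian_group (Rloc R x)"
    proof (rule abelian_groupI)
      fix C assume "C \<in> carrier (Rloc R x)"
      then show "\<exists>D\<in>carrier (Rloc R x). D \<oplus>\<^bsub>Rloc R x\<^esub> C = \<zero>\<^bsub>Rloc R x\<^esub>"
        by (intro bexI[of _ "\<ominus>\<^bsub>Mloc R (self_mod R) x\<^esub> C"]) (simp_all add: Rloc_simps A.l_neg)
    qed (simp_all add: Rloc_simps A.a_ac)
    show "comm_monoid (Rloc R x)"
    proof (rule comm_monoidI)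
      fix C D assume "C \<in> carrier (Rloc R x)" "D \<in> carrier (Rloc R x)"
      then obtain a b k l where "a \<in> carrier R" "C = rfrac a k" "b \<in> carrier R" "D = rfrac b l"
        unfolding Rloc_simps carrier_Mloc by auto
      then show "C \<otimes>\<^bsub>Rloc R x\<^esub> D \<in> carrier (Rloc R x)" "C \<otimes>\<^bsub>Rloc R x\<^esub> D = D \<otimes>\<^bsub>Rloc R x\<^esub> C"
        by (auto simp: Rloc_simps smult_frac[OF S] m_comm add.commute)
    next
      fix C D E assume "C \<in> carrier (Rloc R x)" "D \<in> carrier (Rloc R x)" "E \<in> carrier (Rloc R x)"
      then obtain a b c k l p where "a \<in> carrier R" "C = rfrac a k" "b \<in> carrier R" "D = rfrac b l"
        "c \<in> carrier R" "E = rfrac c p"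
        unfolding Rloc_simps carrier_Mloc by auto
      then show "C \<otimes>\<^bsub>Rloc R x\<^esub> D \<otimes>\<^bsub>Rloc R x\<^esub> E = C \<otimes>\<^bsub>Rloc R x\<^esub> (D \<otimes>\<^bsub>Rloc R x\<^esub> E)"
        by (simp add: Rloc_simps smult_frac[OF S] m_assoc add.assoc)
    next
      fix C assume "C \<in> carrier (Rloc R x)"
      then obtain a k where "a \<in> carrier R" "C = rfrac a k"
        unfolding Rloc_simps carrier_Mloc by auto
      then show "\<one>\<^bsub>Rloc R x\<^esub> \<otimes>\<^bsub>Rloc R x\<^esub> C = C" by (simp add: Rloc_simps smult_frac[OF S])
    qed (simp add: Rloc_simps)
  next
    fix C D E assume "C \<in> carrier (Rloc R x)" "D \<in> carrier (Rloc R x)" "E \<in> carrier (Rloc R x)"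
    then obtain a b k c l where "a \<in> carrier R" "b \<in> carrier R" "C = rfrac a k" "D = rfrac b k"
      "c \<in> carrier R" "E = rfrac c l"
      unfolding Rloc_simps using common_denominator2[OF S] Mloc_cases by (metis self_mod_simps(1))
    then show "(C \<oplus>\<^bsub>Rloc R x\<^esub> D) \<otimes>\<^bsub>Rloc R x\<^esub> E =
        C \<otimes>\<^bsub>Rloc R x\<^esub> E \<oplus>\<^bsub>Rloc R x\<^esub> D \<otimes>\<^bsub>Rloc R x\<^esub> E"
      by (simp add: Rloc_simps smult_frac[OF S] add_frac_same[OF S] l_distr)
  qed
qed

lemma module_Mloc:
  assumes "module R M"
  shows "module (Rloc R x) (Mloc R M x)"
proof (rule moduleI)
  interpret M: module R M by fact
  note S = module_self_mod
  note [simp] = Rloc_simps smult_frac[OF assms] smult_frac[OF S]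
    add_frac_same[OF assms] add_frac_same[OF S]
  show "cring (Rloc R x)" by (rule cring_Rloc)
  show "abelian_group (Mloc R M x)" by (rule abelian_group_Mloc[OF assms])
  {
    fix C D assume C: "C \<in> carrier (Rloc R x)" and D: "D \<in> carrier (Mloc R M x)"
    obtain a k where "a \<in> carrier R" "C = rfrac a k"
      using C unfolding Rloc_simps carrier_Mloc by auto
    moreover obtain m l where "m \<in> carrier M" "D = frac M m l" using D by (rule Mloc_cases)
    ultimately show "C \<odot>\<^bsub>Mloc R M x\<^esub> D \<in> carrier (Mloc R M x)" by simp
  next
    fix C C' D assume C: "C \<in> carrier (Rloc R x)" "C' \<in> carrier (Rloc R x)"
      and D: "D \<in> carrier (Mloc R M x)"
    obtain a b k where "a \<in> carrier R" "b \<in> carrier R" "C = rfrac a k" "C' = rfrac b k"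
      using common_denominator2[OF S C[unfolded Rloc_simps(1)]] by auto
    moreover obtain m l where "m \<in> carrier M" "D = frac M m l" using D by (rule Mloc_cases)
    ultimately show "(C \<oplus>\<^bsub>Rloc R x\<^esub> C') \<odot>\<^bsub>Mloc R M x\<^esub> D =
        C \<odot>\<^bsub>Mloc R M x\<^esub> D \<oplus>\<^bsub>Mloc R M x\<^esub> C' \<odot>\<^bsub>Mloc R M x\<^esub> D"
      by (simp add: M.smult_l_distr)
  next
    fix C D D' assume C: "C \<in> carrier (Rloc R x)"
      and D: "D \<in> carrier (Mloc R M x)" "D' \<in> carrier (Mloc R M x)"
    obtain a k where "a \<in> carrier R" "C = rfrac a k"
      using C unfolding Rloc_simps carrier_Mloc by auto
    moreover obtain m n l where "m \<in> carrier M" "n \<in> carrier M" "D = frac M m l" "D' = frac M n l"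
      using D by (rule common_denominator2[OF assms])
    ultimately show "C \<odot>\<^bsub>Mloc R M x\<^esub> (D \<oplus>\<^bsub>Mloc R M x\<^esub> D') =
        C \<odot>\<^bsub>Mloc R M x\<^esub> D \<oplus>\<^bsub>Mloc R M x\<^esub> C \<odot>\<^bsub>Mloc R M x\<^esub> D'"
      by (simp add: M.smult_r_distr)
  next
    fix C C' D assume C: "C \<in> carrier (Rloc R x)" "C' \<in> carrier (Rloc R x)"
      and D: "D \<in> carrier (Mloc R M x)"
    obtain a k b l where "a \<in> carrier R" "C = rfrac a k" "b \<in> carrier R" "C' = rfrac b l"
      using C unfolding Rloc_simps carrier_Mloc by auto
    moreover obtain m p where "m \<in> carrier M" "D = frac M m p" using D by (rule Mloc_cases)
    ultimately show "(C \<otimes>\<^bsub>Rloc R x\<^esub> C') \<odot>\<^bsub>Mloc R M x\<^esub> D =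
        C \<odot>\<^bsub>Mloc R M x\<^esub> (C' \<odot>\<^bsub>Mloc R M x\<^esub> D)"
      by (simp add: M.smult_assoc1 add.assoc)
  next
    fix D assume "D \<in> carrier (Mloc R M x)"
    then obtain m l where "m \<in> carrier M" "D = frac M m l" by (rule Mloc_cases)
    then show "\<one>\<^bsub>Rloc R x\<^esub> \<odot>\<^bsub>Mloc R M x\<^esub> D = D" by simp
  }
qed

text \<open>Equality of fractions is an equation between scalar multiples of numerators, which a
  bijection compatible with scalars preserves and reflects. Hence the image of a whole class is a
  whole class, and a localized isomorphism is simply the image map, with no choice of
  representatives.\<close>

lemma image_frac:
  assumes "module R M" "module R N" "m \<in> carrier M"
    and h: "\<And>m. m \<in> carrier M \<Longrightarrow> h m \<in> carrier N" and g: "\<And>n. n \<in> carrier N \<Longrightarrow> g n \<in> carrier M"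
    and gh: "\<And>m. m \<in> carrier M \<Longrightarrow> g (h m) = m" and hg: "\<And>n. n \<in> carrier N \<Longrightarrow> h (g n) = n"
    and hs: "\<And>r m. r \<in> carrier R \<Longrightarrow> m \<in> carrier M \<Longrightarrow> h (r \<odot>\<^bsub>M\<^esub> m) = r \<odot>\<^bsub>N\<^esub> h m"
  shows "map_prod h id ` frac M m k = frac N (h m) k"
proof -
  have iff: "(n, l) \<in> frac M m k \<longleftrightarrow> (h n, l) \<in> frac N (h m) k" if n: "n \<in> carrier M" for n l
  proof -
    have "x [^] (j + k) \<odot>\<^bsub>M\<^esub> n = x [^] (j + l) \<odot>\<^bsub>M\<^esub> m \<longleftrightarrow>
        x [^] (j + k) \<odot>\<^bsub>N\<^esub> h n = x [^] (j + l) \<odot>\<^bsub>N\<^esub> h m" for j :: nat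
    proof -
      interpret M: module R M by fact
      have "x [^] (j + k) \<odot>\<^bsub>M\<^esub> n \<in> carrier M" "x [^] (j + l) \<odot>\<^bsub>M\<^esub> m \<in> carrier M"
        using n assms(3) by auto
      then have "x [^] (j + k) \<odot>\<^bsub>M\<^esub> n = x [^] (j + l) \<odot>\<^bsub>M\<^esub> m \<longleftrightarrow>
          h (x [^] (j + k) \<odot>\<^bsub>M\<^esub> n) = h (x [^] (j + l) \<odot>\<^bsub>M\<^esub> m)"
        by (metis gh)
      then show ?thesis using n assms(3) by (simp add: hs)
    qed
    then show ?thesis
      using assms(1-3) n h by (simp add: mem_frac_iff frac_eq_iff)
  qed
  show ?thesis
  proof (intro equalityI subsetI)
    fix p assume "p \<in> map_prod h id ` frac M m k"
    then obtain n l where "(n, l) \<in> frac M m k" "p = (h n, l)" by auto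
    then show "p \<in> frac N (h m) k" using iff mem_frac_iff[OF assms(1)] by auto
  next
    fix p assume p: "p \<in> frac N (h m) k"
    obtain n l where nl: "p = (n, l)" by force
    with p have "n \<in> carrier N" using mem_frac_iff[OF assms(2)] by blast
    then have "(g n, l) \<in> frac M m k" "p = map_prod h id (g n, l)"
      using p nl iff[OF g] hg by auto
    then show "p \<in> map_prod h id ` frac M m k" by blast
  qed
qed

lemma iso_mod_Mloc:
  assumes "iso_mod R M N"
  shows "iso_mod (Rloc R x) (Mloc R M x) (Mloc R N x)"
proof -
  obtain h g where M: "module R M" and N: "module R N"
    and h: "\<And>m. m \<in> carrier M \<Longrightarrow> h m \<in> carrier N" and g: "\<And>n. n \<in> carrier N \<Longrightarrow> g n \<in> carrier M"
    and gh: "\<And>m. m \<in> carrier M \<Longrightarrow> g (h m) = m" and hg: "\<And>n. n \<in> carrier N \<Longrightarrow> h (g n) = n"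
    and ha: "\<And>m n. m \<in> carrier M \<Longrightarrow> n \<in> carrier M \<Longrightarrow> h (m \<oplus>\<^bsub>M\<^esub> n) = h m \<oplus>\<^bsub>N\<^esub> h n"
    and hs: "\<And>r m. r \<in> carrier R \<Longrightarrow> m \<in> carrier M \<Longrightarrow> h (r \<odot>\<^bsub>M\<^esub> m) = r \<odot>\<^bsub>N\<^esub> h m"
    and gs: "\<And>r m. r \<in> carrier R \<Longrightarrow> m \<in> carrier N \<Longrightarrow> g (r \<odot>\<^bsub>N\<^esub> m) = r \<odot>\<^bsub>M\<^esub> g m"
    by (rule iso_modE[OF assms]) (rule that; (assumption | blast))
  interpret M: module R M by fact
  interpret N: module R N by fact
  note H = image_frac[OF M N _ h g gh hg hs] and G = image_frac[OF N M _ g h hg gh gs]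
  show ?thesis
  proof (rule iso_modI[where h = "\<lambda>C. map_prod h id ` C" and k = "\<lambda>C. map_prod g id ` C"])
    fix C assume "C \<in> carrier (Mloc R M x)"
    then obtain m k where "m \<in> carrier M" "C = frac M m k" by (rule Mloc_cases)
    then show "map_prod h id ` C \<in> carrier (Mloc R N x)" "map_prod g id ` map_prod h id ` C = C"
      using H G h gh by auto
  next
    fix C assume "C \<in> carrier (Mloc R N x)"
    then obtain m k where "m \<in> carrier N" "C = frac N m k" by (rule Mloc_cases)
    then show "map_prod g id ` C \<in> carrier (Mloc R M x)" "map_prod h id ` map_prod g id ` C = C"
      using H G g hg by auto
  next
    fix C D assume "C \<in> carrier (Mloc R M x)" "D \<in> carrier (Mloc R M x)"
    then obtain m n k where "m \<in> carrier M" "n \<in> carrier M" "C = frac M m k" "D = frac M n k"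
      by (rule common_denominator2[OF M])
    then show "map_prod h id ` (C \<oplus>\<^bsub>Mloc R M x\<^esub> D) =
        map_prod h id ` C \<oplus>\<^bsub>Mloc R N x\<^esub> map_prod h id ` D"
      using h by (simp add: H add_frac_same[OF M] add_frac_same[OF N] ha)
  next
    fix C D assume C: "C \<in> carrier (Rloc R x)" and D: "D \<in> carrier (Mloc R M x)"
    obtain a k where "a \<in> carrier R" "C = rfrac a k"
      using C unfolding Rloc_simps carrier_Mloc by auto
    moreover obtain m l where "m \<in> carrier M" "D = frac M m l" using D by (rule Mloc_cases)
    ultimately show "map_prod h id ` (C \<odot>\<^bsub>Mloc R M x\<^esub> D) = C \<odot>\<^bsub>Mloc R N x\<^esub> map_prod h id ` D"
      using h by (simp add: H smult_frac[OF M] smult_frac[OF N] hs)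
  qed (use M N in \<open>auto intro: module_Mloc\<close>)
qed

end

section \<open>Ranks and localization\<close>

context localized_cring
begin

lemma pow_notin_primeideal:
  assumes "primeideal P R" "x \<notin> P"
  shows "x [^] (k::nat) \<notin> P"
proof -
  interpret P: primeideal P R by fact
  show ?thesis
  proof (induction k)
    case 0
    show ?case using P.I_notcarr P.one_imp_carrier by auto
  next
    case (Suc k)
    then show ?case using P.I_prime[of "x [^] k" x] assms(2) by auto
  qed
qed

text \<open>This is why denominators may be cleared when testing coordinates against
  \<open>P\<close>.\<close>

lemma pow_mult_in_primeideal_iff:
  assumes "primeideal P R" "x \<notin> P" "r \<in> carrier R"
  shows "x [^] (k::nat) \<otimes> r \<in> P \<longleftrightarrow> r \<in> P"
proof -
  interpret P: primeideal P R by fact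
  show ?thesis
    using P.I_prime[of "x [^] k" r] pow_notin_primeideal[OF assms(1,2)] assms(3)
      P.I_l_closed[of r "x [^] k"] by auto
qed

text \<open>A homomorphism maps \<open>P\<cdot>M\<close> into \<open>P\<cdot>N\<close>; the coordinates of an element are treated one by one.\<close>

lemma hom_preserves_ideal_coordinates:
  assumes P: "primeideal P R" and a: "idfam a n" and b: "idfam b m"
    and closed: "\<And>C. C \<in> carrier (Mloc R (idmod b) x) \<Longrightarrow> h C \<in> carrier (Mloc R (idmod a) x)"
    and add: "\<And>C D. C \<in> carrier (Mloc R (idmod b) x) \<Longrightarrow> D \<in> carrier (Mloc R (idmod b) x) \<Longrightarrow>
      h (C \<oplus>\<^bsub>Mloc R (idmod b) x\<^esub> D) = h C \<oplus>\<^bsub>Mloc R (idmod a) x\<^esub> h D"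
    and smult: "\<And>C D. C \<in> carrier (Rloc R x) \<Longrightarrow> D \<in> carrier (Mloc R (idmod b) x) \<Longrightarrow>
      h (C \<odot>\<^bsub>Mloc R (idmod b) x\<^esub> D) = C \<odot>\<^bsub>Mloc R (idmod a) x\<^esub> h D"
    and w: "w \<in> carrier (idmod b)" "\<And>i. w i \<in> P"
  shows "\<exists>z l. z \<in> carrier (idmod a) \<and> (\<forall>i. z i \<in> P) \<and> h (frac (idmod b) w 0) = frac (idmod a) z l"
proof -
  interpret P: primeideal P R by (rule P)
  note A = module_idmod[of a, OF idfam_carrier[OF a]] and B = module_idmod[of b, OF idfam_carrier[OF b]]
  interpret A: module R "idmod a" by (rule A)
  interpret B: module R "idmod b" by (rule B)
  \<comment> \<open>Nothing is known about the image of \<open>v\<close>, but \<open>r\<close> can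
    be pulled out of \<open>h\<close>, and \<open>r\<close> times any numerator has its coordinates
    in \<open>P\<close>.\<close>
  have scale: "\<exists>z l. z \<in> carrier (idmod a) \<and> (\<forall>i. z i \<in> P) \<and>
      h (frac (idmod b) (r \<odot>\<^bsub>idmod b\<^esub> v) 0) = frac (idmod a) z l"
    if r: "r \<in> P" and v: "v \<in> carrier (idmod b)" for r v
  proof -
    have rc: "r \<in> carrier R" using r by (rule P.a_Hcarr)
    obtain z l where z: "z \<in> carrier (idmod a)" "h (frac (idmod b) v 0) = frac (idmod a) z l"
      using closed[OF frac_in_carrier[OF v]] by (rule Mloc_cases)
    have "h (frac (idmod b) (r \<odot>\<^bsub>idmod b\<^esub> v) 0) = h (rfrac r 0 \<odot>\<^bsub>Mloc R (idmod b) x\<^esub> frac (idmod b) v 0)"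
      unfolding smult_frac[OF B rc v] by simp
    also have "\<dots> = rfrac r 0 \<odot>\<^bsub>Mloc R (idmod a) x\<^esub> frac (idmod a) z l"
      unfolding z(2)[symmetric] using rc v by (intro smult) (simp_all add: Rloc_simps)
    also have "\<dots> = frac (idmod a) (r \<odot>\<^bsub>idmod a\<^esub> z) l"
      unfolding smult_frac[OF A rc z(1)] by simp
    finally have "h (frac (idmod b) (r \<odot>\<^bsub>idmod b\<^esub> v) 0) = frac (idmod a) (r \<odot>\<^bsub>idmod a\<^esub> z) l" .
    moreover have "r \<odot>\<^bsub>idmod a\<^esub> z \<in> carrier (idmod a)" using rc z(1) by (rule A.smult_closed)
    moreover have "(r \<odot>\<^bsub>idmod a\<^esub> z) i \<in> P" for i
      using P.I_r_closed[OF r idmod_memD(1)[OF z(1)]] by simp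
    ultimately show ?thesis by blast
  qed
  \<comment> \<open>The bound \<open>N\<close> on the support of \<open>w\<close> is there for
    induction; the bound \<open>m\<close> of the family \<open>b\<close> is a valid choice of
    it.\<close>
  have "\<exists>z l. z \<in> carrier (idmod a) \<and> (\<forall>i. z i \<in> P) \<and> h (frac (idmod b) w 0) = frac (idmod a) z l"
    if "w \<in> carrier (idmod b)" "\<And>i. w i \<in> P" "\<And>i. i \<ge> N \<Longrightarrow> w i = \<zero>" for N w
    using that
  proof (induction N arbitrary: w)
    case 0
    then have "w = \<zero> \<odot>\<^bsub>idmod b\<^esub> w" using P.a_Hcarr by (auto simp: fun_eq_iff)
    then show ?case using scale[OF P.zero_closed 0(1)] by simp
  next
    case (Suc N)
    \<comment> \<open>The vector \<open>?u\<close> is the generator \<open>b N\<close> of the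
      summand in slot \<open>N\<close>. Since \<open>b N\<close> fixes \<open>w N\<close>,
      subtracting \<open>w N\<close> times \<open>?u\<close> from \<open>w\<close> just clears that
      slot.\<close>
    let ?v = "w(N := \<zero>)" and ?u = "(\<lambda>_. \<zero>)(N := b N)"
    have v: "?v \<in> carrier (idmod b)"
      using Suc.prems(1) idfam_carrier[OF b] by (simp add: carrier_idmod)
    have u: "?u \<in> carrier (idmod b)"
      using idfam_carrier[OF b] b by (simp add: carrier_idmod idfam_def idem_def)
    have "w N \<otimes> b N = w N"
      using idmod_memD[OF Suc.prems(1), of N] idfam_carrier[OF b, of N] by (simp add: m_comm)
    then have w_eq: "w = ?v \<oplus>\<^bsub>idmod b\<^esub> (w N \<odot>\<^bsub>idmod b\<^esub> ?u)"
      using idmod_memD(1)[OF Suc.prems(1)] by (auto simp: fun_eq_iff)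
    have uN: "w N \<odot>\<^bsub>idmod b\<^esub> ?u \<in> carrier (idmod b)"
      using idmod_memD(1)[OF Suc.prems(1)] u by (rule B.smult_closed)
    have "\<exists>z l. z \<in> carrier (idmod a) \<and> (\<forall>i. z i \<in> P) \<and> h (frac (idmod b) ?v 0) = frac (idmod a) z l"
    proof (rule Suc.IH[OF v])
      show "?v i \<in> P" for i using Suc.prems(2) by simp
      show "?v i = \<zero>" if "i \<ge> N" for i using Suc.prems(3)[of i] that by (cases "i = N") auto
    qed
    then obtain z l where z: "z \<in> carrier (idmod a)" "\<forall>i. z i \<in> P"
      "h (frac (idmod b) ?v 0) = frac (idmod a) z l" by blast
    obtain z' l' where z': "z' \<in> carrier (idmod a)" "\<forall>i. z' i \<in> P"
      "h (frac (idmod b) (w N \<odot>\<^bsub>idmod b\<^esub> ?u) 0) = frac (idmod a) z' l'"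
      using scale[OF Suc.prems(2) u] by blast
    let ?z = "x [^] l' \<odot>\<^bsub>idmod a\<^esub> z \<oplus>\<^bsub>idmod a\<^esub> x [^] l \<odot>\<^bsub>idmod a\<^esub> z'"
    have "h (frac (idmod b) w 0) =
        h (frac (idmod b) ?v 0 \<oplus>\<^bsub>Mloc R (idmod b) x\<^esub> frac (idmod b) (w N \<odot>\<^bsub>idmod b\<^esub> ?u) 0)"
      unfolding add_frac_same[OF B v uN] using w_eq by simp
    also have "\<dots> = frac (idmod a) ?z (l + l')"
      unfolding add[OF frac_in_carrier[OF v] frac_in_carrier[OF uN]] z(3) z'(3)
      by (rule add_frac[OF A z(1) z'(1)])
    finally have "h (frac (idmod b) w 0) = frac (idmod a) ?z (l + l')" .
    moreover have "?z \<in> carrier (idmod a)"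
      using z(1) z'(1) by (intro A.M.a_closed A.smult_closed) auto
    moreover have "?z i \<in> P" for i
      using z(2) z'(2) by (auto intro!: P.a_closed P.I_l_closed)
    ultimately show ?case by blast
  qed
  note this[OF w, of m]
  moreover have "w i = \<zero>" if "i \<ge> m" for i
    using idmod_memD[OF w(1), of i] that b by (simp add: idfam_def)
  ultimately show ?thesis by blast
qed

text \<open>With more summands of \<open>a\<close> than of \<open>b\<close> outside
  \<open>P\<close>, elimination yields \<open>v\<close> with a coordinate outside \<open>P\<close>
  whose image \<open>w\<close> has all coordinates in \<open>P\<close>. The inverse sends
  \<open>w\<close> to a fraction \<open>z / x^l\<close> with \<open>z\<close> in \<open>P\<close>
  coordinatewise. This fraction equals \<open>v\<close>, so a power of \<open>x\<close> multiplies
  \<open>v\<close> into \<open>P\<close>, which is impossible as \<open>x\<close> is outside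
  \<open>P\<close>.\<close>

lemma rank_le_if_iso_Mloc:
  assumes P: "primeideal P R" and x: "x \<notin> P" and a: "idfam a n" and b: "idfam b m"
    and iso: "iso_mod (Rloc R x) (Mloc R (idmod a) x) (Mloc R (idmod b) x)"
  shows "card {i. a i \<notin> P} \<le> card {i. b i \<notin> P}"
proof (rule ccontr)
  assume less: "\<not> card {i. a i \<notin> P} \<le> card {i. b i \<notin> P}"
  interpret P: primeideal P R by (rule P)
  note ac = idfam_carrier[OF a] and bc = idfam_carrier[OF b]
  note A = module_idmod[of a, OF ac] and B = module_idmod[of b, OF bc]
  interpret A: module R "idmod a" by (rule A)
  interpret B: module R "idmod b" by (rule B)
  let ?A = "Mloc R (idmod a) x" and ?B = "Mloc R (idmod b) x"
  obtain h k
    where h: "\<And>C. C \<in> carrier ?A \<Longrightarrow> h C \<in> carrier ?B"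
      and k: "\<And>C. C \<in> carrier ?B \<Longrightarrow> k C \<in> carrier ?A"
      and kh: "\<And>C. C \<in> carrier ?A \<Longrightarrow> k (h C) = C"
      and ha: "\<And>C D. C \<in> carrier ?A \<Longrightarrow> D \<in> carrier ?A \<Longrightarrow> h (C \<oplus>\<^bsub>?A\<^esub> D) = h C \<oplus>\<^bsub>?B\<^esub> h D"
      and hs: "\<And>r C. r \<in> carrier (Rloc R x) \<Longrightarrow> C \<in> carrier ?A \<Longrightarrow> h (r \<odot>\<^bsub>?A\<^esub> C) = r \<odot>\<^bsub>?B\<^esub> h C"
      and ka: "\<And>C D. C \<in> carrier ?B \<Longrightarrow> D \<in> carrier ?B \<Longrightarrow> k (C \<oplus>\<^bsub>?B\<^esub> D) = k C \<oplus>\<^bsub>?A\<^esub> k D"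
      and ks: "\<And>r C. r \<in> carrier (Rloc R x) \<Longrightarrow> C \<in> carrier ?B \<Longrightarrow> k (r \<odot>\<^bsub>?B\<^esub> C) = r \<odot>\<^bsub>?A\<^esub> k C"
    by (rule iso_modE[OF iso]) (rule that; (assumption | blast))
  \<comment> \<open>The part of the graph of \<open>h\<close> on which argument and value both have
    denominator 1. It is closed under \<open>R\<close>-linear combinations, so the elimination takes
    place in \<open>R\<close>.\<close>
  define L where "L = {(v, w). v \<in> carrier (idmod a) \<and> w \<in> carrier (idmod b) \<and>
    h (frac (idmod a) v 0) = frac (idmod b) w 0}"
  have L_smult: "(r \<odot>\<^bsub>idmod a\<^esub> v, r \<odot>\<^bsub>idmod b\<^esub> w) \<in> L" if "(v, w) \<in> L" "r \<in> carrier R" for v w r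
  proof -
    from that have vw: "v \<in> carrier (idmod a)" "w \<in> carrier (idmod b)"
      "h (frac (idmod a) v 0) = frac (idmod b) w 0" by (auto simp: L_def)
    have "h (frac (idmod a) (r \<odot>\<^bsub>idmod a\<^esub> v) 0) = h (rfrac r 0 \<odot>\<^bsub>?A\<^esub> frac (idmod a) v 0)"
      unfolding smult_frac[OF A that(2) vw(1)] by simp
    also have "\<dots> = rfrac r 0 \<odot>\<^bsub>?B\<^esub> frac (idmod b) w 0"
      unfolding vw(3)[symmetric] using that(2) vw(1) by (intro hs) (simp_all add: Rloc_simps)
    also have "\<dots> = frac (idmod b) (r \<odot>\<^bsub>idmod b\<^esub> w) 0"
      unfolding smult_frac[OF B that(2) vw(2)] by simp
    finally show ?thesis
      unfolding L_def using A.smult_closed[OF that(2) vw(1)] B.smult_closed[OF that(2) vw(2)] by simp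
  qed
  have L_add: "(v \<oplus>\<^bsub>idmod a\<^esub> v', w \<oplus>\<^bsub>idmod b\<^esub> w') \<in> L"
    if "(v, w) \<in> L" "(v', w') \<in> L" for v w v' w'
  proof -
    from that have vw: "v \<in> carrier (idmod a)" "w \<in> carrier (idmod b)"
      "h (frac (idmod a) v 0) = frac (idmod b) w 0" "v' \<in> carrier (idmod a)" "w' \<in> carrier (idmod b)"
      "h (frac (idmod a) v' 0) = frac (idmod b) w' 0" by (auto simp: L_def)
    have "h (frac (idmod a) (v \<oplus>\<^bsub>idmod a\<^esub> v') 0) = frac (idmod b) (w \<oplus>\<^bsub>idmod b\<^esub> w') 0"
      unfolding add_frac_same[OF A vw(1,4), symmetric] add_frac_same[OF B vw(2,5), symmetric]
        vw(3,6)[symmetric] using vw(1,4) by (intro ha) simp_all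
    then show ?thesis
      unfolding L_def using A.M.a_closed[OF vw(1,4)] B.M.a_closed[OF vw(2,5)] by simp
  qed
  \<comment> \<open>The image of the generator \<open>a i\<close> has some denominator
    \<open>x^k\<close>; scaling the generator by \<open>x^k\<close> clears it. Its entry
    \<open>x^k \<otimes> a i\<close> is still outside \<open>P\<close> whenever \<open>a i\<close>
    is.\<close>
  have "\<exists>k w. ((\<lambda>l. if l = i then x [^] (k::nat) \<otimes> a i else \<zero>), w) \<in> L" for i
  proof -
    let ?u = "(\<lambda>_. \<zero>)(i := a i)"
    have u: "?u \<in> carrier (idmod a)"
      using ac a by (simp add: carrier_idmod idfam_def idem_def)
    obtain w k where w: "w \<in> carrier (idmod b)" "h (frac (idmod a) ?u 0) = frac (idmod b) w k"
      using h[OF frac_in_carrier[OF u]] by (rule Mloc_cases)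
    have p: "x [^] k \<in> carrier R" by simp
    have "h (frac (idmod a) (x [^] k \<odot>\<^bsub>idmod a\<^esub> ?u) 0) = h (rfrac (x [^] k) 0 \<odot>\<^bsub>?A\<^esub> frac (idmod a) ?u 0)"
      unfolding smult_frac[OF A p u] by simp
    also have "\<dots> = rfrac (x [^] k) 0 \<odot>\<^bsub>?B\<^esub> frac (idmod b) w k"
      unfolding w(2)[symmetric] using u by (intro hs) (simp_all add: Rloc_simps)
    also have "\<dots> = frac (idmod b) w 0"
      unfolding smult_frac[OF B p w(1)] using frac_cancel[OF B w(1), of k 0] by simp
    finally have "(x [^] k \<odot>\<^bsub>idmod a\<^esub> ?u, w) \<in> L"
      unfolding L_def using A.smult_closed[OF p u] w(1) by simp
    moreover have "x [^] k \<odot>\<^bsub>idmod a\<^esub> ?u = (\<lambda>l. if l = i then x [^] k \<otimes> a i else \<zero>)"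
      using ac by (auto simp: fun_eq_iff)
    ultimately show ?thesis by auto
  qed
  then obtain K W where KW: "\<And>i. ((\<lambda>l. if l = i then x [^] (K i :: nat) \<otimes> a i else \<zero>), W i) \<in> L"
    by metis
  have fin: "finite {i. c i \<notin> P}" if "idfam c l" for c l
    by (rule finite_subset[OF _ idfam_finite[OF that]]) auto
  have "\<exists>(v, w)\<in>L. (\<exists>i\<in>{i. a i \<notin> P}. v i \<notin> P) \<and> (\<forall>j\<in>{j. b j \<notin> P}. w j \<in> P)"
  proof (rule exists_kernel_vector[OF P fin[OF b] fin[OF a]])
    show "card {j. b j \<notin> P} < card {i. a i \<notin> P}" using less by simp
    show "v i \<in> carrier R \<and> w i \<in> carrier R" if "(v, w) \<in> L" for v w i
      using that idmod_memD(1) by (auto simp: L_def)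
    show "(\<lambda>i. p \<otimes> v i \<ominus> q \<otimes> v' i, \<lambda>i. p \<otimes> w i \<ominus> q \<otimes> w' i) \<in> L"
      if L: "(v, w) \<in> L" "(v', w') \<in> L" and pq: "p \<in> carrier R" "q \<in> carrier R" for v w v' w' p q
    proof -
      have "v' i \<in> carrier R" "w' i \<in> carrier R" for i
        using L(2) idmod_memD(1) by (auto simp: L_def)
      then show ?thesis
        using L_add[OF L_smult[OF L(1) pq(1)] L_smult[OF L(2), of "\<ominus> q"]] pq
        by (simp add: minus_eq l_minus)
    qed
    show "((\<lambda>l. if l = i then x [^] K i \<otimes> a i else \<zero>), W i) \<in> L" for i by (rule KW)
    show "(if i = i then x [^] K i \<otimes> a i else \<zero>) \<notin> P" if "i \<in> {i. a i \<notin> P}" for i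
      using that pow_mult_in_primeideal_iff[OF P x ac] by simp
  qed simp
  then obtain v w i where vw: "(v, w) \<in> L" "v i \<notin> P" "\<And>j. b j \<notin> P \<Longrightarrow> w j \<in> P" by blast
  then have v: "v \<in> carrier (idmod a)" and w: "w \<in> carrier (idmod b)"
    and hv: "h (frac (idmod a) v 0) = frac (idmod b) w 0"
    by (auto simp: L_def)
  \<comment> \<open>Elimination controls only the slots with \<open>b j\<close> outside
    \<open>P\<close>; in the others \<open>w j = b j \<otimes> w j\<close> lies in \<open>P\<close>
    anyway.\<close>
  have "w j \<in> P" for j
  proof (cases "b j \<in> P")
    case True
    then have "b j \<otimes> w j \<in> P" using idmod_memD(1)[OF w] by (rule P.I_r_closed)
    then show ?thesis using idmod_memD(2)[OF w] by simp
  qed (rule vw(3))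
  then obtain z l where z: "z \<in> carrier (idmod a)" "\<forall>i. z i \<in> P"
    "k (frac (idmod b) w 0) = frac (idmod a) z l"
    using hom_preserves_ideal_coordinates[OF P a b k ka ks w] by blast
  have "frac (idmod a) v 0 = frac (idmod a) z l"
    using z(3) kh[OF frac_in_carrier[OF v, of 0]] unfolding hv by simp
  then obtain j :: nat where "x [^] (j + l) \<odot>\<^bsub>idmod a\<^esub> v = x [^] (j + 0) \<odot>\<^bsub>idmod a\<^esub> z"
    using frac_eq_iff[OF A v z(1)] by blast
  then have "x [^] (j + l) \<otimes> v i = x [^] j \<otimes> z i" by (simp add: fun_eq_iff)
  moreover have "x [^] j \<otimes> z i \<in> P" using z(2) by (auto intro: P.I_l_closed)
  ultimately have "x [^] (j + l) \<otimes> v i \<in> P" by simp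
  then show False using pow_mult_in_primeideal_iff[OF P x idmod_memD(1)[OF v]] vw(2) by blast
qed

end

theorem theorem2p6:
  fixes R :: "'a ring" and M :: "('a, 'm) module" and N :: "('a, 'n) module"
    and f :: "nat \<Rightarrow> 'a" and n :: nat
  assumes "cring R"
    and "refinement_ring R"
    and "\<forall>i\<in>{1..n}. f i \<in> carrier R \<and> f i \<noteq> \<zero>\<^bsub>R\<^esub>"
    and "Idl\<^bsub>R\<^esub> (f ` {1..n}) = carrier R"
    and "fg_projective R M" and "fg_projective R N"
  shows "iso_mod R M N \<longleftrightarrow>
           (\<forall>i\<in>{1..n}. iso_mod (Rloc R (f i)) (Mloc R M (f i)) (Mloc R N (f i)))"
proof
  interpret plain_cring R using assms(1) by (rule plain_cring.intro)
  have loc: "localized_cring R (f i)" if "i \<in> {1..n}" for i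
    using assms(3) that by unfold_locales auto
  {
    assume "iso_mod R M N"
    then show "\<forall>i\<in>{1..n}. iso_mod (Rloc R (f i)) (Mloc R M (f i)) (Mloc R N (f i))"
      using localized_cring.iso_mod_Mloc[OF loc] by blast
  next
    assume iso: "\<forall>i\<in>{1..n}. iso_mod (Rloc R (f i)) (Mloc R M (f i)) (Mloc R N (f i))"
    obtain a k where a: "idfam a k" "iso_mod R M (idmod a)"
      by (rule fg_projective_iso_idmod[OF assms(2,5)])
    obtain b l where b: "idfam b l" "iso_mod R N (idmod b)"
      by (rule fg_projective_iso_idmod[OF assms(2,6)])
    have "iso_mod R (idmod a) (idmod b)"
    proof (rule idmod_iso_if_rank_eq[OF a(1) b(1)])
      fix P assume P: "primeideal P R"
      interpret P: primeideal P R by (rule P)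
      \<comment> \<open>Otherwise the generated ideal, all of \<open>R\<close>, would be contained
        in the proper ideal \<open>P\<close>.\<close>
      have "\<not> f ` {1..n} \<subseteq> P"
        using genideal_minimal[OF P.ideal_axioms, of "f ` {1..n}"] assms(4) P.I_notcarr P.a_subset by auto
      then obtain i where i: "i \<in> {1..n}" "f i \<notin> P" by blast
      interpret localized_cring R "f i" by (rule loc[OF i(1)])
      have "iso_mod (Rloc R (f i)) (Mloc R (idmod a) (f i)) (Mloc R M (f i))"
        by (rule iso_mod_Mloc[OF iso_mod_sym[OF a(2)]])
      also have "iso_mod (Rloc R (f i)) \<dots> (Mloc R N (f i))" using iso i(1) by blast
      also have "iso_mod (Rloc R (f i)) \<dots> (Mloc R (idmod b) (f i))"
        by (rule iso_mod_Mloc[OF b(2)])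
      finally have ab: "iso_mod (Rloc R (f i)) (Mloc R (idmod a) (f i)) (Mloc R (idmod b) (f i))" .
      show "card {i. a i \<notin> P} = card {i. b i \<notin> P}"
        using rank_le_if_iso_Mloc[OF P i(2) a(1) b(1) ab]
          rank_le_if_iso_Mloc[OF P i(2) b(1) a(1) iso_mod_sym[OF ab]] by (rule antisym)
    qed
    with a(2) b(2) show "iso_mod R M N" by (blast intro: iso_mod_trans iso_mod_sym)
  }
qed

end
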